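(* Let $\gamma_s\le 1/6$ for all $s$ and let $(W_n)_{n=1}^\infty$ be the Widom factors for $\mu_{K(\gamma)}$. Then (a) $\liminf_{s\to\infty}W_{2^s}=\liminf_{n\to\infty}W_n$; (b) $\limsup_{n\to\infty}W_n=\infty$.
   Context: $\mathbb{N}_0=\mathbb{N}\cup\{0\}$. Let $\gamma=(\gamma_s)_{s=1}^\infty$ with $0<\gamma_s<1/4$ for all $s$. Put $r_0=1$ and $r_s=\gamma_s r_{s-1}^2$ for $s\ge 1$. Define polynomials recursively by $P_1(x)=x-1$ and $P_{2^{s+1}}(x)=P_{2^s}(x)\,(P_{2^s}(x)+r_s)$ for $s\in\mathbb{N}_0$. Let $E_s=\{x\in\mathbb{R}: P_{2^{s+1}}(x)\le 0\}$; then $E_{s+1}\subset E_s$ and $K(\gamma)=\bigcap_{s=0}^\infty E_s$ is a (compact) Cantor set. It is assumed throughout that $K(\gamma)$ has positive logarithmic capacity, $Cap(K(\gamma))=\exp\left(\sum_{k=1}^\infty 2^{-k}\log\gamma_k\right)>0$. $\mu_{K(\gamma)}$ is the equilibrium measure of $K(\gamma)$, $\|\cdot\|$ is the norm of $L^2(\mu_{K(\gamma)})$, and $Q_n$ is the monic orthogonal polynomial of degree $n$ with respect to $\mu_{K(\gamma)}$. The Widom factors for $\mu_{K(\gamma)}$ are $W_n=\|Q_n\|/(Cap(K(\gamma)))^n$, $n\in\mathbb{N}$. *)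

theory Defs
  imports "HOL-Probability.Probability"
begin

section \<open>Logarithmic capacity and equilibrium measures of compact subsets of the real line\<close>

text \<open>
  A measure carried by a set of reals has the same logarithmic energy whether it is regarded as
  a measure on the line or in the plane, so for compact \<open>K\<close> in the reals the notions
  below are the planar ones.
\<close>

text \<open>For compact \<open>K\<close> these are the Borel probability measures with support contained in \<open>K\<close>.\<close>

definition prob_measures_on :: "real set \<Rightarrow> real measure set" where
  "prob_measures_on K = {\<mu>. prob_space \<mu> \<and> sets \<mu> = sets borel \<and> (AE x in \<mu>. x \<in> K)}"

definition log_kernel :: "real \<Rightarrow> real \<Rightarrow> ereal" where
  "log_kernel x y = (if x = y then \<infinity> else ereal (ln (1 / \<bar>x - y\<bar>)))"

text \<open>
  The integral of \<open>log_kernel\<close> against \<open>\<mu>\<close> times \<open>\<mu>\<close>, as the difference of the integrals of its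
  positive and negative parts (\<open>e2ennreal\<close> maps negative numbers to 0).  For compactly supported
  \<open>\<mu>\<close> the second integral is finite, so the difference is well defined, possibly infinite.
\<close>

definition log_energy :: "real measure \<Rightarrow> ereal" where
  "log_energy \<mu> =
     enn2ereal (\<integral>\<^sup>+ (x, y). e2ennreal (log_kernel x y) \<partial>(\<mu> \<Otimes>\<^sub>M \<mu>))
   - enn2ereal (\<integral>\<^sup>+ (x, y). e2ennreal (- log_kernel x y) \<partial>(\<mu> \<Otimes>\<^sub>M \<mu>))"

text \<open>
  Meant for compact \<open>K\<close>, where the infimum of the energies is never minus infinity.
  The empty set has capacity 0.
\<close>

definition log_capacity :: "real set \<Rightarrow> real" where
  "log_capacity K =
     (let V = (INF \<mu>\<in>prob_measures_on K. log_energy \<mu>)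
      in if V = \<infinity> then 0 else exp (- real_of_ereal V))"

text \<open>
  For compact \<open>K\<close> of positive capacity there is exactly one such \<open>\<mu>\<close>.
\<close>

definition equilibrium_measure :: "real set \<Rightarrow> real measure \<Rightarrow> bool" where
  "equilibrium_measure K \<mu> \<longleftrightarrow>
     \<mu> \<in> prob_measures_on K \<and> (\<forall>\<nu>\<in>prob_measures_on K. log_energy \<mu> \<le> log_energy \<nu>)"

section \<open>Orthogonal polynomials and Widom factors\<close>

definition monic_orthogonal_poly :: "real measure \<Rightarrow> nat \<Rightarrow> real poly" where
  "monic_orthogonal_poly \<mu> n =
     (THE q. degree q = n \<and> lead_coeff q = 1 \<and>
        (\<forall>p. degree p < n \<longrightarrow> (LINT x|\<mu>. poly q x * poly p x) = 0))"

definition L2_norm_poly :: "real measure \<Rightarrow> real poly \<Rightarrow> real" where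
  "L2_norm_poly \<mu> q = sqrt (LINT x|\<mu>. (poly q x)\<^sup>2)"

definition widom_factor :: "real set \<Rightarrow> real measure \<Rightarrow> nat \<Rightarrow> real" where
  "widom_factor K \<mu> n = L2_norm_poly \<mu> (monic_orthogonal_poly \<mu> n) / log_capacity K ^ n"

section \<open>The Cantor sets\<close>

text \<open>The parameters are \<open>\<gamma> 1, \<gamma> 2, \<dots>\<close>; the value \<open>\<gamma> 0\<close> is never used.\<close>

fun cantor_r :: "(nat \<Rightarrow> real) \<Rightarrow> nat \<Rightarrow> real" where
  "cantor_r \<gamma> 0 = 1"
| "cantor_r \<gamma> (Suc s) = \<gamma> (Suc s) * (cantor_r \<gamma> s)\<^sup>2"

text \<open>\<open>cantor_poly \<gamma> s\<close> is the polynomial usually indexed by its degree \<open>2 ^ s\<close>.\<close>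

fun cantor_poly :: "(nat \<Rightarrow> real) \<Rightarrow> nat \<Rightarrow> real poly" where
  "cantor_poly \<gamma> 0 = [:-1, 1:]"
| "cantor_poly \<gamma> (Suc s) = cantor_poly \<gamma> s * (cantor_poly \<gamma> s + [:cantor_r \<gamma> s:])"

definition cantor_level :: "(nat \<Rightarrow> real) \<Rightarrow> nat \<Rightarrow> real set" where
  "cantor_level \<gamma> s = {x. poly (cantor_poly \<gamma> (Suc s)) x \<le> 0}"

definition cantor_set :: "(nat \<Rightarrow> real) \<Rightarrow> real set" where
  "cantor_set \<gamma> = (\<Inter>s. cantor_level \<gamma> s)"

end

theory Submission
  imports Defs "HOL-Real_Asymp.Real_Asymp"
begin

text \<open>
  Put \<open>T s = P + r s / 2\<close>, where \<open>P\<close> is the polynomial of degree \<open>2 ^ s\<close>.  The recursion becomes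
  \<open>T (s + 1) = (T s)\<^sup>2 - c s\<close> with \<open>c s = (1 - 2 \<gamma> (s + 1)) (r s)\<^sup>2 / 4\<close>, so the Cantor set is a
  generalised Julia set of real quadratic maps, and everything rests on one property of its
  equilibrium measure \<open>\<mu>\<close>: under \<open>\<mu>\<close> the law \<open>M s\<close> of \<open>T s\<close> has vanishing odd moments for every \<open>s\<close>.

  This symmetry comes from energy minimality.  If \<open>M\<close> minimises the logarithmic energy on a set that
  is symmetric about \<open>0\<close>, then lifting a measure on the image of \<open>x \<mapsto> x\<^sup>2 - c\<close> to the two square
  roots with equal weights halves the energy.  Comparing \<open>M\<close> with the lift of its own image shows
  that the energy of \<open>M\<close> is at most its reflected energy, the integral of \<open>- ln \<bar>x + y\<bar>\<close>.  The
  Chebyshev expansion of the logarithmic kernel shows the opposite inequality, with a surplus that is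
  a positive multiple of the square of any odd Chebyshev moment
  (\<open>reflected_energy_gap\<close>).  So all these moments vanish, the image of \<open>M\<close> is again a minimiser,
  and its energy is exactly twice that of \<open>M\<close> (\<open>energy_minimiser_square\<close>).  By induction on \<open>s\<close> the
  symmetry holds at all levels, and since \<open>M s\<close> lives on an interval of length \<open>r s\<close>,
  the doubling of the energy yields \<open>Cap ^ 2 ^ s \<le> r s\<close>.  Upper bounds for the capacity turn into lower
  bounds for Widom factors, and both claims are consequences of such lower bounds.

  Let \<open>h s n\<close> be the squared norm of the \<open>n\<close>-th monic orthogonal polynomial of \<open>M s\<close>, and
  \<open>a s n = h s n / h s (n - 1)\<close>.  Symmetry of \<open>M s\<close> and \<open>M (s + 1)\<close> gives
  \<open>h s (2 n) = h (s + 1) n\<close>, \<open>a s (2 n) + a s (2 n + 1) = c s\<close> and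
  \<open>a s (2 n) a s (2 n - 1) = a (s + 1) n\<close>.  The bound \<open>\<gamma> s \<le> 1/6\<close> ensures \<open>c (s + 1) \<le> (c s)\<^sup>2 / 4\<close>,
  and this keeps \<open>a s n \<ge> c s / 2\<close> for odd \<open>n\<close> (\<open>a_odd_ge\<close>).

  For (a), each binary digit \<open>1\<close> of \<open>n\<close> in position \<open>i\<close> contributes to the squared Widom factor
  \<open>W n ^ 2\<close> a factor at least
  \<open>(c i / 2) / Cap ^ (2 * 2 ^ i)\<close>, and this is at least \<open>1\<close> by the capacity bound.  Dropping all
  digits but the leading one gives \<open>W (2 ^ k) \<le> W n\<close> for \<open>2 ^ k \<le> n < 2 ^ (k + 1)\<close>.
  For (b), \<open>a 0 (2 ^ k)\<close> is at most \<open>c 0 / 2 ^ k\<close>, because halving the index gains a factor \<open>2\<close> at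
  each level; hence \<open>W (2 ^ k - 1)\<close> grows at least like \<open>sqrt (2 ^ k)\<close>.
\<close>

section \<open>Chebyshev expansion of the logarithmic kernel\<close>

fun cheb :: "nat \<Rightarrow> real \<Rightarrow> real" where
  "cheb 0 x = 1"
| "cheb (Suc 0) x = x"
| "cheb (Suc (Suc n)) x = 2 * x * cheb (Suc n) x - cheb n x"

lemma cheb_cos: "cheb n (cos t) = cos (real n * t)"
proof (induction n rule: induct_nat_012)
  case (ge2 n)
  have "cos (t + real (Suc n) * t) + cos (t - real (Suc n) * t) = 2 * cos t * cos (real (Suc n) * t)"
    unfolding cos_add cos_diff by simp
  moreover have "cos (t - real (Suc n) * t) = cos (real n * t)"
    by (subst cos_minus[symmetric]) (simp add: algebra_simps)
  ultimately show ?case using ge2 by (simp add: algebra_simps)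
qed auto

lemma abs_cheb_le_1: "\<bar>x\<bar> \<le> 1 \<Longrightarrow> \<bar>cheb n x\<bar> \<le> 1"
  using cheb_cos[of n "arccos x"] by (simp add: abs_le_iff cos_arccos)

lemma cheb_minus: "cheb n (- x) = (-1) ^ n * cheb n x"
  by (induction n rule: induct_nat_012) (simp_all add: algebra_simps)

lemma cheb_measurable [measurable]: "cheb n \<in> borel_measurable borel"
  by (induction n rule: induct_nat_012) simp_all

text \<open>
  For \<open>x = cos t\<close> and \<open>y = cos u\<close> this is the product of \<open>\<bar>1 - r exp (\<i> (t + u))\<bar>\<^sup>2\<close> and
  \<open>\<bar>1 - r exp (\<i> (t - u))\<bar>\<^sup>2\<close>; at \<open>r = 1\<close> it becomes \<open>4 (x - y)\<^sup>2\<close>.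
\<close>

definition poisson_denom :: "real \<Rightarrow> real \<Rightarrow> real \<Rightarrow> real" where
  "poisson_denom r x y = (1 - r\<^sup>2)\<^sup>2 - 4 * r * (1 + r\<^sup>2) * x * y + 4 * r\<^sup>2 * (x\<^sup>2 + y\<^sup>2)"

text \<open>
  The real part of the power series of \<open>- Ln (1 - z)\<close> at \<open>z = r exp (\<i> a)\<close>.
\<close>

lemma cosine_log_series:
  fixes r a :: real
  assumes r: "0 < r" "r < 1"
  shows "(\<lambda>n. r ^ n / real n * cos (real n * a)) sums (- ln (1 - 2 * r * cos a + r\<^sup>2) / 2)"
proof -
  define z where "z = of_real r * cis a"
  have nz: "cmod z < 1" using r by (simp add: z_def norm_mult)
  have ne: "1 - z \<noteq> 0" using nz by auto
  have "(\<lambda>n. - (z ^ n) / of_nat n) sums Ln (1 - z)"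
    using Ln_series'[of "-z"] nz by simp
  from sums_minus[OF sums_Re[OF this]]
  have s: "(\<lambda>n. - Re (- (z ^ n) / of_nat n)) sums (- ln (cmod (1 - z)))"
    using ne by simp
  have "Re (- (z ^ n) / of_nat n) = - (r ^ n / real n * cos (real n * a))" for n
    by (simp add: z_def power_mult_distrib Complex.DeMoivre Re_divide_of_nat flip: of_real_power)
  moreover have "(cmod (1 - z))\<^sup>2 = 1 - 2 * r * cos a + r\<^sup>2"
    by (simp add: cmod_power2 z_def power2_diff power_mult_distrib sin_squared_eq algebra_simps)
  then have "ln (1 - 2 * r * cos a + r\<^sup>2) = 2 * ln (cmod (1 - z))"
    using ne by (metis ln_realpow norm_eq_zero of_nat_numeral zero_less_norm_iff)
  moreover have "- (- (r ^ n / real n * cos (real n * a))) = r ^ n / real n * cos (real n * a)" for n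
    by simp
  ultimately show ?thesis using s by (simp only:) simp
qed

text \<open>
  The first summand bounds the smoothed kernel by the logarithmic one, the second keeps the smoothed
  kernel bounded for fixed \<open>r\<close>.
\<close>

lemma poisson_denom_lower:
  assumes "0 < r" "r < 1" "\<bar>x\<bar> \<le> 1" "\<bar>y\<bar> \<le> 1"
  shows "4 * r\<^sup>2 * (x - y)\<^sup>2 + (1 - r) ^ 4 \<le> poisson_denom r x y"
proof -
  have xy: "x * y \<le> 1" using assms mult_le_one[of "\<bar>x\<bar>" "\<bar>y\<bar>"] abs_ge_self[of "x * y"] by (simp add: abs_mult)
  have "poisson_denom r x y - 4 * r\<^sup>2 * (x - y)\<^sup>2 = (1 - r)\<^sup>2 * ((1 - r)\<^sup>2 + 4 * r * (1 - x * y))"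
    unfolding poisson_denom_def by algebra
  also have "\<dots> \<ge> (1 - r)\<^sup>2 * (1 - r)\<^sup>2"
    using xy assms by (intro mult_left_mono) auto
  finally show ?thesis by (simp flip: power_add)
qed

lemma poisson_denom_pos:
  assumes "0 < r" "r < 1" "\<bar>x\<bar> \<le> 1" "\<bar>y\<bar> \<le> 1"
  shows "0 < poisson_denom r x y"
proof -
  have "0 < (1 - r) ^ 4" using assms by simp
  moreover have "0 \<le> 4 * r\<^sup>2 * (x - y)\<^sup>2" by simp
  ultimately show ?thesis using poisson_denom_lower[OF assms] by linarith
qed

lemma poisson_denom_upper:
  assumes "0 < r" "r < 1" "\<bar>x\<bar> \<le> 1" "\<bar>y\<bar> \<le> 1"
  shows "poisson_denom r x y \<le> 16"
proof -
  have r2: "r\<^sup>2 \<le> 1" using assms by (simp add: abs_square_le_1)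
  have xy: "\<bar>x * y\<bar> \<le> 1" using assms mult_le_one[of "\<bar>x\<bar>" "\<bar>y\<bar>"] by (simp add: abs_mult)
  have "x\<^sup>2 \<le> 1" "y\<^sup>2 \<le> 1" using assms by (simp_all add: abs_square_le_1)
  then have xy2: "x\<^sup>2 + y\<^sup>2 \<le> 2" by linarith
  have "\<bar>r * (1 + r\<^sup>2) * (x * y)\<bar> \<le> 2"
  proof -
    have "r * (1 + r\<^sup>2) \<le> 1 * 2" using assms r2 by (intro mult_mono) auto
    then have "r * (1 + r\<^sup>2) * \<bar>x * y\<bar> \<le> 2 * 1" using xy assms by (intro mult_mono) auto
    then show ?thesis using assms by (simp add: abs_mult)
  qed
  moreover have "r\<^sup>2 * (x\<^sup>2 + y\<^sup>2) \<le> 1 * 2"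
    using xy2 r2 by (intro mult_mono) auto
  moreover have "(1 - r\<^sup>2)\<^sup>2 + 4 * r\<^sup>2 * (x\<^sup>2+y\<^sup>2) \<le> (1 - r\<^sup>2)\<^sup>2 + 4 * r\<^sup>2 * 2"
    using xy2 by (intro add_mono mult_left_mono) auto
  moreover have "(1 - r\<^sup>2)\<^sup>2 + 4 * r\<^sup>2 * 2 \<le> 8"
  proof -
    have "(1 - r\<^sup>2)\<^sup>2 + 4 * r\<^sup>2 * 2 = 8 - (1 - r\<^sup>2) * (7 + r\<^sup>2)" by (simp add: power2_eq_square algebra_simps)
    moreover have "0 \<le> (1 - r\<^sup>2) * (7 + r\<^sup>2)" using r2 by simp
    ultimately show ?thesis by linarith
  qed
  ultimately have "(1 - r\<^sup>2)\<^sup>2 - 4 * (r * (1 + r\<^sup>2) * (x * y)) + 4 * r\<^sup>2 * (x\<^sup>2 + y\<^sup>2) \<le> 16"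
    by linarith
  then show ?thesis unfolding poisson_denom_def by (simp add: mult.assoc)
qed

text \<open>
  Abel summation of \<open>- ln (2 \<bar>x - y\<bar>) = (\<Sum>n. (2 / n) cheb n x cheb n y)\<close>: the product of two cosines
  splits into the cosines of \<open>t + u\<close> and \<open>t - u\<close>, each summed by \<open>cosine_log_series\<close>.  The expansion
  shows that the kernel is positive definite on measures of total mass zero.  At \<open>n = 0\<close> the
  coefficient is \<open>0\<close>, as \<open>2 / 0 = 0\<close>.
\<close>

lemma chebyshev_kernel_series:
  assumes r: "0 < r" "r < 1" and x: "\<bar>x\<bar> \<le> 1" and y: "\<bar>y\<bar> \<le> 1"
  shows "(\<lambda>n. 2 / real n * r ^ n * (cheb n x * cheb n y)) sums (- ln (poisson_denom r x y) / 2)"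
proof -
  define a b where "a = arccos x" and "b = arccos y"
  have xa: "x = cos a" and yb: "y = cos b" using x y by (auto simp: a_def b_def)
  have ca: "cheb n x = cos (real n * a)" "cheb n y = cos (real n * b)" for n
    by (simp_all add: xa yb cheb_cos)
  define p q where "p = 1 - 2 * r * cos (a + b) + r\<^sup>2" and "q = 1 - 2 * r * cos (a - b) + r\<^sup>2"
  have low: "0 < 1 - 2 * r * cos t + r\<^sup>2" for t
  proof -
    have "r * cos t \<le> r * 1" using r by (intro mult_left_mono) auto
    moreover have "0 < (1 - r)\<^sup>2" using r by simp
    ultimately show ?thesis by (simp add: power2_eq_square algebra_simps)
  qed
  have pq: "p * q = poisson_denom r x y"
  proof -
    have s: "(sin a)\<^sup>2 = 1 - x\<^sup>2" "(sin b)\<^sup>2 = 1 - y\<^sup>2" by (simp_all add: xa yb sin_squared_eq)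
    have "p * q = (1 + r\<^sup>2 - 2 * r * x * y)\<^sup>2 - 4 * r\<^sup>2 * ((sin a)\<^sup>2 * (sin b)\<^sup>2)"
      unfolding p_def q_def xa yb cos_add cos_diff by algebra
    also have "\<dots> = poisson_denom r x y" unfolding s poisson_denom_def by algebra
    finally show ?thesis .
  qed
  have "(\<lambda>n. r ^ n / real n * cos (real n * (a + b)) + r ^ n / real n * cos (real n * (a - b)))
      sums (- ln p / 2 + - ln q / 2)"
    unfolding p_def q_def by (intro sums_add cosine_log_series r)
  also have "- ln p / 2 + - ln q / 2 = - ln (poisson_denom r x y) / 2"
    using low[of "a + b"] low[of "a - b"] by (simp add: ln_mult_pos flip: pq p_def q_def)
  also have "(\<lambda>n. r ^ n / real n * cos (real n * (a + b)) + r ^ n / real n * cos (real n * (a - b)))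
     = (\<lambda>n. 2 / real n * r ^ n * (cheb n x * cheb n y))"
    by (rule ext) (simp add: ca ring_distribs cos_add cos_diff add_divide_distrib)
  finally show ?thesis .
qed

section \<open>Logarithmic energy and reflection\<close>

text \<open>
  The positive part of the kernel.  Below, all measures live on sets of diameter at most \<open>1\<close>, where
  the kernel is nonnegative, so energies can be handled as plain nonnegative integrals.
\<close>

definition log_kernel_ennreal :: "real \<Rightarrow> real \<Rightarrow> ennreal" where
  "log_kernel_ennreal x y = e2ennreal (log_kernel x y)"

definition energy :: "real measure \<Rightarrow> ennreal" where
  "energy M = (\<integral>\<^sup>+x. \<integral>\<^sup>+y. log_kernel_ennreal x y \<partial>M \<partial>M)"

definition reflected_energy :: "real measure \<Rightarrow> ennreal" where
  "reflected_energy M = (\<integral>\<^sup>+x. \<integral>\<^sup>+y. log_kernel_ennreal x (- y) \<partial>M \<partial>M)"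

lemma log_kernel_ennreal_eq: "log_kernel_ennreal x y = (if x = y then \<infinity> else ennreal (- ln \<bar>x - y\<bar>))"
  by (simp add: log_kernel_ennreal_def log_kernel_def ln_div e2ennreal_ereal flip: infinity_ennreal_def)

lemma log_kernel_ennreal_measurable [measurable]:
  "(\<lambda>p. log_kernel_ennreal (fst p) (snd p)) \<in> borel_measurable (borel \<Otimes>\<^sub>M borel)"
  unfolding log_kernel_ennreal_eq by measurable

lemma log_kernel_ennreal_measurable' [measurable (raw)]:
  "f \<in> borel_measurable M \<Longrightarrow> g \<in> borel_measurable M \<Longrightarrow> (\<lambda>x. log_kernel_ennreal (f x) (g x)) \<in> borel_measurable M"
  using measurable_compose[OF measurable_Pair log_kernel_ennreal_measurable, of f M g] by simp

text \<open>
  The interval \<open>[-1/2, 1/2]\<close> has diameter \<open>1\<close> and lies inside \<open>[-1, 1]\<close>: the kernel is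
  nonnegative on it and its reflection, and the Chebyshev expansion applies.
\<close>

definition half_interval_prob :: "real measure \<Rightarrow> bool" where
  "half_interval_prob M \<longleftrightarrow> prob_space M \<and> sets M = sets borel \<and> (AE x in M. \<bar>x\<bar> \<le> 1/2)"

lemma poisson_denom_tendsto:
  assumes r: "r \<longlonglongrightarrow> 1"
  shows "(\<lambda>j. poisson_denom (r j) x y) \<longlonglongrightarrow> 4 * (x - y)\<^sup>2"
proof -
  have "(\<lambda>j. poisson_denom (r j) x y) \<longlonglongrightarrow> poisson_denom 1 x y"
    unfolding poisson_denom_def by (intro tendsto_intros r)
  also have "poisson_denom 1 x y = 4 * (x - y)\<^sup>2" 
    unfolding poisson_denom_def by (simp add: power2_eq_square algebra_simps)
  finally show ?thesis .
qed

text \<open>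
  The Abel means of the kernel, shifted by \<open>ln 4\<close> to be nonnegative.  In the limit \<open>r \<rightarrow> 1\<close> they tend
  to \<open>ln 2 - ln \<bar>x - y\<bar>\<close>, which explains the constants \<open>ln 2\<close> below.
\<close>

definition abel_kernel :: "real \<Rightarrow> real \<Rightarrow> real \<Rightarrow> real" where
  "abel_kernel r x y = ln 4 - ln (poisson_denom r x y) / 2"

lemma abel_kernel_nonneg:
  assumes "0 < r" "r < 1" "\<bar>x\<bar> \<le> 1" "\<bar>y\<bar> \<le> 1"
  shows "0 \<le> abel_kernel r x y"
proof -
  have "ln (poisson_denom r x y) \<le> ln (4\<^sup>2)"
    using poisson_denom_upper[OF assms] poisson_denom_pos[OF assms] by (subst ln_le_cancel_iff) auto
  also have "\<dots> = 2 * ln 4" by (subst ln_realpow) auto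
  finally show ?thesis by (simp add: abel_kernel_def)
qed

lemma abel_kernel_bound:
  assumes "0 < r" "r < 1" "\<bar>x\<bar> \<le> 1" "\<bar>y\<bar> \<le> 1"
  shows "abel_kernel r x y \<le> ln 4 - ln ((1 - r) ^ 4) / 2"
proof -
  have "0 \<le> 4 * r\<^sup>2 * (x - y)\<^sup>2" by simp
  then have "(1 - r) ^ 4 \<le> poisson_denom r x y" using poisson_denom_lower[OF assms] by linarith
  then have "ln ((1 - r) ^ 4) \<le> ln (poisson_denom r x y)"
    using assms by (intro ln_mono) auto
  then show ?thesis by (simp add: abel_kernel_def)
qed

lemma abel_kernel_le_log_kernel_ennreal:
  assumes r: "0 < r" "r < 1" and x: "\<bar>x\<bar> \<le> 1/2" and y: "\<bar>y\<bar> \<le> 1/2"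
  shows "ennreal (abel_kernel r x y) \<le> ennreal (ln 2 - ln r) + log_kernel_ennreal x y"
proof (cases "x = y")
  case False
  have "0 \<le> (1 - r) ^ 4" by simp
  then have "4 * r\<^sup>2 * (x - y)\<^sup>2 \<le> poisson_denom r x y"
    using poisson_denom_lower[of r x y] assms by linarith
  then have "(2 * r * \<bar>x - y\<bar>)\<^sup>2 \<le> poisson_denom r x y" by (simp add: power_mult_distrib)
  moreover have pos: "0 < 2 * r * \<bar>x - y\<bar>" using False r by simp
  ultimately have "ln ((2 * r * \<bar>x - y\<bar>)\<^sup>2) \<le> ln (poisson_denom r x y)"
    by (intro ln_mono) auto
  moreover have "ln ((2 * r * \<bar>x - y\<bar>)\<^sup>2) = 2 * (ln 2 + ln r + ln \<bar>x - y\<bar>)"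
    using False r by (simp add: ln_realpow ln_mult_pos)
  moreover have "ln (4::real) = 2 * ln 2" using ln_realpow[of "2::real" 2] by simp
  ultimately have "abel_kernel r x y \<le> (ln 2 - ln r) + - ln \<bar>x - y\<bar>"
    by (simp add: abel_kernel_def)
  then have "ennreal (abel_kernel r x y) \<le> ennreal ((ln 2 - ln r) + - ln \<bar>x - y\<bar>)"
    by (rule ennreal_leI)
  also have "\<dots> = ennreal (ln 2 - ln r) + ennreal (- ln \<bar>x - y\<bar>)"
  proof (rule ennreal_plus)
    have "ln r < 0" "0 < ln (2::real)" using r by auto
    then show "0 \<le> ln 2 - ln r" by linarith
    have "\<bar>x - y\<bar> \<le> 1" using x y by linarith
    then show "0 \<le> - ln \<bar>x - y\<bar>" using False by simp
  qed
  finally show ?thesis using False by (simp add: log_kernel_ennreal_eq)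
qed (simp add: log_kernel_ennreal_eq)

lemma log_kernel_ennreal_le_liminf_abel_kernel:
  assumes r: "\<And>j. 0 < r j \<and> r j < 1" "r \<longlonglongrightarrow> 1" and x: "\<bar>x\<bar> \<le> 1/2" and y: "\<bar>y\<bar> \<le> 1/2"
  shows "ennreal (ln 2) + log_kernel_ennreal x y \<le> liminf (\<lambda>j. ennreal (abel_kernel (r j) x y))"
proof (cases "x = y")
  case False
  have "(\<lambda>j. abel_kernel (r j) x y) \<longlonglongrightarrow> ln 4 - ln (4 * (x - y)\<^sup>2) / 2"
    unfolding abel_kernel_def using False by (intro tendsto_intros poisson_denom_tendsto r) auto
  also have "ln 4 - ln (4 * (x - y)\<^sup>2) / 2 = ln 2 + - ln \<bar>x - y\<bar>"
  proof -
    have "4 * (x - y)\<^sup>2 = (2 * \<bar>x - y\<bar>)\<^sup>2" by (simp add: power_mult_distrib)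
    then have "ln (4 * (x - y)\<^sup>2) = 2 * (ln 2 + ln \<bar>x - y\<bar>)"
      using False by (simp only: ln_realpow) (simp add: ln_realpow ln_mult_pos)
    moreover have "ln (4::real) = 2 * ln 2" using ln_realpow[of "2::real" 2] by simp
    ultimately show ?thesis by (simp add: add_divide_distrib)
  qed
  finally have "(\<lambda>j. ennreal (abel_kernel (r j) x y)) \<longlonglongrightarrow> ennreal (ln 2 + - ln \<bar>x - y\<bar>)"
    by (rule tendsto_ennrealI)
  moreover have "ennreal (ln 2 + - ln \<bar>x - y\<bar>) = ennreal (ln 2) + log_kernel_ennreal x y"
    using x y False by (subst ennreal_plus) (auto simp: log_kernel_ennreal_eq abs_le_iff)
  ultimately show ?thesis by (simp add: lim_imp_Liminf)
next
  case True
  have "(\<lambda>j. ennreal (abel_kernel (r j) x y)) \<longlonglongrightarrow> \<infinity>"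
    unfolding infinity_ennreal_def tendsto_top_iff_ennreal
  proof safe
    fix l :: real assume "0 \<le> l"
    have "eventually (\<lambda>j. poisson_denom (r j) x y < exp (2 * (ln 4 - l))) sequentially"
      using poisson_denom_tendsto[OF r(2), of x y] True by (intro order_tendstoD(2)) auto
    then show "\<forall>\<^sub>F j in sequentially. ennreal l < ennreal (abel_kernel (r j) x y)"
    proof eventually_elim
      case (elim j)
      have p: "0 < poisson_denom (r j) x y" using r(1)[of j] x y by (intro poisson_denom_pos) auto
      then have "ln (poisson_denom (r j) x y) < 2 * (ln 4 - l)"
        using elim by (metis exp_gt_zero ln_exp ln_less_cancel_iff)
      then have "l < abel_kernel (r j) x y" by (simp add: abel_kernel_def)
      then show ?case using \<open>0 \<le> l\<close> by (simp add: ennreal_less_iff)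
    qed
  qed
  then have "liminf (\<lambda>j. ennreal (abel_kernel (r j) x y)) = \<infinity>" by (rule lim_imp_Liminf[rotated]) simp
  then show ?thesis by simp
qed

lemma abel_kernel_measurable [measurable]:
  "f \<in> borel_measurable M \<Longrightarrow> g \<in> borel_measurable M \<Longrightarrow> (\<lambda>x. abel_kernel r (f x) (g x)) \<in> borel_measurable M"
  unfolding abel_kernel_def poisson_denom_def by simp

text \<open>
  Reflecting \<open>y\<close> changes the sign of the terms with odd \<open>n\<close>, so the difference retains only these.
\<close>

lemma odd_part_series:
  assumes r: "0 < r" "r < 1" and x: "\<bar>x\<bar> \<le> 1" and y: "\<bar>y\<bar> \<le> 1"
  shows "(\<lambda>n. 2 / real n * r ^ n * (1 - (-1) ^ n) * (cheb n x * cheb n y))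
           sums (abel_kernel r x y - abel_kernel r x (- y))"
proof -
  have "(\<lambda>n. 2 / real n * r ^ n * (cheb n x * cheb n y) - 2 / real n * r ^ n * (cheb n x * cheb n (- y)))
      sums (- ln (poisson_denom r x y) / 2 - - ln (poisson_denom r x (- y)) / 2)"
    using y by (intro sums_diff chebyshev_kernel_series r x) auto
  then show ?thesis by (simp add: abel_kernel_def cheb_minus algebra_simps diff_divide_distrib)
qed

lemma half_interval_prob_pair_AE:
  assumes M: "half_interval_prob M"
  shows "AE p in M \<Otimes>\<^sub>M M. \<bar>fst p\<bar> \<le> 1/2 \<and> \<bar>snd p\<bar> \<le> 1/2"
proof -
  interpret prob_space M using M by (simp add: half_interval_prob_def)
  interpret pair_prob_space M M ..
  have [measurable_cong]: "sets M = sets borel" using M by (simp add: half_interval_prob_def)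
  have AE: "AE x in M. \<bar>x\<bar> \<le> 1/2" using M by (simp add: half_interval_prob_def)
  have "AE x in M. AE y in M. \<bar>x\<bar> \<le> 1/2 \<and> \<bar>y\<bar> \<le> 1/2"
    using AE by eventually_elim (use AE in auto)
  then show ?thesis by (subst (asm) AE_pair_iff) measurable
qed

lemma cheb_product_integral:
  assumes M: "half_interval_prob M"
  shows "(LINT p|(M \<Otimes>\<^sub>M M). cheb n (fst p) * cheb n (snd p)) = (LINT x|M. cheb n x)\<^sup>2"
    and "integrable (M \<Otimes>\<^sub>M M) (\<lambda>p. cheb n (fst p) * cheb n (snd p))"
proof -
  interpret prob_space M using M by (simp add: half_interval_prob_def)
  interpret pair_prob_space M M ..
  have [measurable_cong]: "sets M = sets borel" using M by (simp add: half_interval_prob_def)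
  have "AE p in M \<Otimes>\<^sub>M M. norm (cheb n (fst p) * cheb n (snd p)) \<le> 1"
    using half_interval_prob_pair_AE[OF M]
  proof eventually_elim
    case (elim p)
    then have "\<bar>cheb n (fst p)\<bar> \<le> 1" "\<bar>cheb n (snd p)\<bar> \<le> 1"
      by (auto intro!: abs_cheb_le_1)
    then show ?case using mult_le_one[of "\<bar>cheb n (fst p)\<bar>" "\<bar>cheb n (snd p)\<bar>"] by (simp add: abs_mult)
  qed
  then show int: "integrable (M \<Otimes>\<^sub>M M) (\<lambda>p. cheb n (fst p) * cheb n (snd p))"
    by (rule P.integrable_const_bound) measurable
  have "(LINT p|(M \<Otimes>\<^sub>M M). cheb n (fst p) * cheb n (snd p)) = (LINT x|M. LINT y|M. cheb n x * cheb n y)"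
    using integral_fst'[OF int] by simp
  then show "(LINT p|(M \<Otimes>\<^sub>M M). cheb n (fst p) * cheb n (snd p)) = (LINT x|M. cheb n x)\<^sup>2"
    by (simp add: power2_eq_square)
qed

text \<open>
  Integrating the odd part of the series term by term gives a sum of squares of odd Chebyshev moments
  with nonnegative coefficients, of which one term is kept.
\<close>

lemma abel_kernel_gap:
  assumes M: "half_interval_prob M" and r: "0 < r" "r < 1" and n: "odd n"
  shows "(\<integral>\<^sup>+p. abel_kernel r (fst p) (- snd p) \<partial>(M \<Otimes>\<^sub>M M)) + ennreal (4 / real n * r ^ n * (LINT x|M. cheb n x)\<^sup>2)
     \<le> (\<integral>\<^sup>+p. abel_kernel r (fst p) (snd p) \<partial>(M \<Otimes>\<^sub>M M))"
proof -
  interpret prob_space M using M by (simp add: half_interval_prob_def)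
  interpret pair_prob_space M M ..
  have [measurable_cong]: "sets M = sets borel" using M by (simp add: half_interval_prob_def)
  note AE = half_interval_prob_pair_AE[OF M]
  let ?P = "M \<Otimes>\<^sub>M M" and ?m = "\<lambda>k. LINT x|M. cheb k x"
  let ?c = "\<lambda>k. 2 / real k * r ^ k * (1 - (-1) ^ k)"
  let ?t = "\<lambda>k p. ?c k * (cheb k (fst p) * cheb k (snd p))"
  \<comment> \<open>The uniform bound of the Abel means for this \<open>r\<close>, from the second summand in \<open>poisson_denom_lower\<close>.\<close>
  let ?K = "ln 4 - ln ((1 - r) ^ 4) / 2"
  have nn: "AE p in ?P. 0 \<le> abel_kernel r (fst p) (snd p)" "AE p in ?P. 0 \<le> abel_kernel r (fst p) (- snd p)"
    using AE by (eventually_elim, use r in \<open>auto intro!: abel_kernel_nonneg\<close>)+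
  have bd: "AE p in ?P. norm (abel_kernel r (fst p) (snd p)) \<le> ?K"
    "AE p in ?P. norm (abel_kernel r (fst p) (- snd p)) \<le> ?K"
    using AE nn by (eventually_elim, use r abel_kernel_bound in force)+
  have int: "integrable ?P (\<lambda>p. abel_kernel r (fst p) (snd p))"
    "integrable ?P (\<lambda>p. abel_kernel r (fst p) (- snd p))"
    by (rule P.integrable_const_bound, rule bd, measurable)+
  have c: "\<bar>?c k\<bar> \<le> 4 * r ^ k" for k
  proof (cases "k = 0")
    case False
    then have "\<bar>2 / real k\<bar> \<le> 2" by (simp add: field_simps)
    moreover have "\<bar>1 - (-1) ^ k\<bar> \<le> (2 :: real)" by (cases "even k") auto
    ultimately have "\<bar>2 / real k\<bar> * \<bar>1 - (-1) ^ k\<bar> \<le> 2 * (2 :: real)" by (intro mult_mono) auto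
    then have "\<bar>2 / real k\<bar> * \<bar>1 - (-1) ^ k\<bar> * r ^ k \<le> 2 * 2 * r ^ k"
      using r by (intro mult_right_mono) auto
    then show ?thesis using r by (simp add: abs_mult mult_ac)
  qed (use r in simp)
  have tb: "AE p in ?P. \<forall>k. \<bar>?t k p\<bar> \<le> 4 * r ^ k"
    using AE
  proof eventually_elim
    case (elim p)
    show ?case
    proof
      fix k
      have "\<bar>cheb k (fst p)\<bar> \<le> 1" "\<bar>cheb k (snd p)\<bar> \<le> 1" using elim by (auto intro!: abs_cheb_le_1)
      then have "\<bar>cheb k (fst p) * cheb k (snd p)\<bar> \<le> 1"
        using mult_le_one[of "\<bar>cheb k (fst p)\<bar>" "\<bar>cheb k (snd p)\<bar>"] by (simp add: abs_mult)
      then have "\<bar>?c k\<bar> * \<bar>cheb k (fst p) * cheb k (snd p)\<bar> \<le> 4 * r ^ k * 1"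
        using c[of k] r by (intro mult_mono) auto
      then show "\<bar>?t k p\<bar> \<le> 4 * r ^ k" by (simp add: abs_mult)
    qed
  qed
  have geo: "summable (\<lambda>k. 4 * r ^ k)" using r by (intro summable_mult summable_geometric) auto
  have tint: "integrable ?P (?t k)" for k using cheb_product_integral(2)[OF M] by simp
  have "(\<lambda>k. integral\<^sup>L ?P (?t k)) sums (LINT p|?P. (\<Sum>k. ?t k p))"
  proof (rule sums_integral)
    show "integrable ?P (?t k)" for k by (rule tint)
    show "AE p in ?P. summable (\<lambda>k. norm (?t k p))"
      using tb by eventually_elim (rule summable_comparison_test'[OF geo, of 0], simp)
    have "(LINT p|?P. norm (?t k p)) \<le> (LINT p|?P. 4 * r ^ k)" for k
      using tb by (intro integral_mono_AE integrable_norm tint) auto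
    then show "summable (\<lambda>k. LINT p|?P. norm (?t k p))"
      by (intro summable_comparison_test'[OF geo, of 0]) (simp add: P.prob_space)
  qed
  also have "(LINT p|?P. (\<Sum>k. ?t k p)) = (LINT p|?P. abel_kernel r (fst p) (snd p) - abel_kernel r (fst p) (- snd p))"
  proof (rule integral_cong_AE)
    show "AE p in ?P. (\<Sum>k. ?t k p) = abel_kernel r (fst p) (snd p) - abel_kernel r (fst p) (- snd p)"
      using AE by eventually_elim (use r odd_part_series in \<open>force intro!: sums_unique[symmetric]\<close>)
  qed measurable
  also have "\<dots> = (LINT p|?P. abel_kernel r (fst p) (snd p)) - (LINT p|?P. abel_kernel r (fst p) (- snd p))"
    by (rule Bochner_Integration.integral_diff[OF int])
  finally have s: "(\<lambda>k. ?c k * (?m k)\<^sup>2) sums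
      ((LINT p|?P. abel_kernel r (fst p) (snd p)) - (LINT p|?P. abel_kernel r (fst p) (- snd p)))"
    by (simp add: cheb_product_integral(1)[OF M])
  have "0 \<le> ?c k * (?m k)\<^sup>2" for k using r by (cases "even k") auto
  then have "?c n * (?m n)\<^sup>2 \<le> (\<Sum>k. ?c k * (?m k)\<^sup>2)"
    using sum_le_suminf[OF sums_summable[OF s], of "{n}"] by simp
  then have le: "(LINT p|?P. abel_kernel r (fst p) (- snd p)) + 4 / real n * r ^ n * (?m n)\<^sup>2
      \<le> (LINT p|?P. abel_kernel r (fst p) (snd p))"
    using n sums_unique[OF s] by simp
  show ?thesis
    using le r by (subst (1 2) nn_integral_eq_integral)
      (auto simp: int nn integral_nonneg_AE simp flip: ennreal_plus intro!: ennreal_leI)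
qed

text \<open>
  Let \<open>r\<close> tend to \<open>1\<close> in \<open>abel_kernel_gap\<close>.  On the reflected side Fatou's lemma suffices; on the other
  side the Abel means are bounded by the kernel itself up to \<open>ln 2 - ln r\<close>.  Thus finiteness of the
  reflected energy is part of the conclusion when the energy is finite.
\<close>

lemma reflected_energy_gap:
  assumes M: "half_interval_prob M" and n: "odd n"
  shows "reflected_energy M + ennreal (4 / real n * (LINT x|M. cheb n x)\<^sup>2) \<le> energy M"
proof -
  interpret prob_space M using M by (simp add: half_interval_prob_def)
  note fubini = nn_integral_fst
  interpret pair_prob_space M M ..
  have [measurable_cong]: "sets M = sets borel" using M by (simp add: half_interval_prob_def)
  note AE = half_interval_prob_pair_AE[OF M]
  let ?P = "M \<Otimes>\<^sub>M M" and ?m = "(LINT x|M. cheb n x)\<^sup>2"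
  define r where "r j = 1 - 1 / real (j + 2)" for j
  have r: "0 < r j \<and> r j < 1" for j by (simp add: r_def)
  have rlim: "r \<longlonglongrightarrow> 1" unfolding r_def by real_asymp
  let ?g = "\<lambda>j. ennreal (4 / real n * r j ^ n * ?m)"
  have glim: "?g \<longlonglongrightarrow> ennreal (4 / real n * 1 ^ n * ?m)"
    by (intro tendsto_ennrealI tendsto_intros rlim)
  have e: "energy M = (\<integral>\<^sup>+p. log_kernel_ennreal (fst p) (snd p) \<partial>?P)"
    unfolding energy_def using fubini[of "\<lambda>p. log_kernel_ennreal (fst p) (snd p)" M] by simp
  have re: "reflected_energy M = (\<integral>\<^sup>+p. log_kernel_ennreal (fst p) (- snd p) \<partial>?P)"
    unfolding reflected_energy_def using fubini[of "\<lambda>p. log_kernel_ennreal (fst p) (- snd p)" M] by simp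
  have "ennreal (ln 2) + reflected_energy M = (\<integral>\<^sup>+p. ennreal (ln 2) + log_kernel_ennreal (fst p) (- snd p) \<partial>?P)"
    unfolding re by (subst nn_integral_add) (auto simp: P.emeasure_space_1)
  also have "\<dots> \<le> (\<integral>\<^sup>+p. liminf (\<lambda>j. ennreal (abel_kernel (r j) (fst p) (- snd p))) \<partial>?P)"
  proof (rule nn_integral_mono_AE)
    show "AE p in ?P. ennreal (ln 2) + log_kernel_ennreal (fst p) (- snd p) \<le> liminf (\<lambda>j. ennreal (abel_kernel (r j) (fst p) (- snd p)))"
      using AE by eventually_elim (use r rlim in \<open>auto intro!: log_kernel_ennreal_le_liminf_abel_kernel\<close>)
  qed
  also have "\<dots> \<le> liminf (\<lambda>j. \<integral>\<^sup>+p. ennreal (abel_kernel (r j) (fst p) (- snd p)) \<partial>?P)"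
    by (intro nn_integral_liminf) measurable
  finally have fatou: "ennreal (ln 2) + reflected_energy M
      \<le> liminf (\<lambda>j. \<integral>\<^sup>+p. ennreal (abel_kernel (r j) (fst p) (- snd p)) \<partial>?P)" .
  have upper: "(\<integral>\<^sup>+p. ennreal (abel_kernel (r j) (fst p) (- snd p)) \<partial>?P) + ?g j
      \<le> ennreal (ln 2 - ln (r j)) + energy M" for j
  proof -
    have "(\<integral>\<^sup>+p. ennreal (abel_kernel (r j) (fst p) (- snd p)) \<partial>?P) + ?g j
      \<le> (\<integral>\<^sup>+p. ennreal (abel_kernel (r j) (fst p) (snd p)) \<partial>?P)"
      using abel_kernel_gap[OF M _ _ n] r by simp
    also have "\<dots> \<le> (\<integral>\<^sup>+p. ennreal (ln 2 - ln (r j)) + log_kernel_ennreal (fst p) (snd p) \<partial>?P)"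
    proof (rule nn_integral_mono_AE)
      show "AE p in ?P. ennreal (abel_kernel (r j) (fst p) (snd p)) \<le> ennreal (ln 2 - ln (r j)) + log_kernel_ennreal (fst p) (snd p)"
        using AE by eventually_elim (use r in \<open>auto intro!: abel_kernel_le_log_kernel_ennreal\<close>)
    qed
    also have "\<dots> = ennreal (ln 2 - ln (r j)) + energy M"
      unfolding e by (subst nn_integral_add) (auto simp: P.emeasure_space_1)
    finally show ?thesis .
  qed
  have "(\<lambda>j. ennreal (ln 2 - ln (r j)) + energy M) \<longlonglongrightarrow> ennreal (ln 2 - ln 1) + energy M"
    by (intro tendsto_intros tendsto_ennrealI rlim) simp
  then have lim: "liminf (\<lambda>j. ennreal (ln 2 - ln (r j)) + energy M) = ennreal (ln 2) + energy M"
    by (subst lim_imp_Liminf) auto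
  \<comment> \<open>Freezing the gap at index \<open>i\<close>, which is allowed since it increases with the index, keeps a constant
    next to the lower limit; \<open>i\<close> goes to infinity afterwards.\<close>
  have "?g i + (ennreal (ln 2) + reflected_energy M) \<le> ennreal (ln 2) + energy M" for i
  proof -
    have "?g i + (ennreal (ln 2) + reflected_energy M)
       \<le> ?g i + liminf (\<lambda>j. \<integral>\<^sup>+p. ennreal (abel_kernel (r j) (fst p) (- snd p)) \<partial>?P)"
      by (intro add_left_mono fatou)
    also have "\<dots> = liminf (\<lambda>j. ?g i + (\<integral>\<^sup>+p. ennreal (abel_kernel (r j) (fst p) (- snd p)) \<partial>?P))"
      by (subst Liminf_const_add) auto
    also have "\<dots> \<le> liminf (\<lambda>j. ennreal (ln 2 - ln (r j)) + energy M)"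
    proof (rule Liminf_mono)
      show "\<forall>\<^sub>F j in sequentially. ?g i + (\<integral>\<^sup>+p. ennreal (abel_kernel (r j) (fst p) (- snd p)) \<partial>?P)
          \<le> ennreal (ln 2 - ln (r j)) + energy M"
        using eventually_ge_at_top[of i]
      proof eventually_elim
        case (elim j)
        have "r i \<le> r j" using elim unfolding r_def by (intro diff_left_mono divide_left_mono) auto
        then have "r i ^ n \<le> r j ^ n" using r[of i] by (intro power_mono) auto
        then have "4 / real n * r i ^ n * ?m \<le> 4 / real n * r j ^ n * ?m"
          by (intro mult_right_mono mult_left_mono) auto
        then have "?g i \<le> ?g j" by (rule ennreal_leI)
        then have "?g i + (\<integral>\<^sup>+p. ennreal (abel_kernel (r j) (fst p) (- snd p)) \<partial>?P)
            \<le> (\<integral>\<^sup>+p. ennreal (abel_kernel (r j) (fst p) (- snd p)) \<partial>?P) + ?g j"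
          by (subst add.commute) (rule add_left_mono)
        then show ?case using upper[of j] by (rule order_trans)
      qed
    qed
    finally show ?thesis unfolding lim .
  qed
  moreover have "(\<lambda>i. ?g i + (ennreal (ln 2) + reflected_energy M))
      \<longlonglongrightarrow> ennreal (4 / real n * 1 ^ n * ?m) + (ennreal (ln 2) + reflected_energy M)"
    by (intro tendsto_add glim tendsto_const)
  ultimately have "ennreal (4 / real n * 1 ^ n * ?m) + (ennreal (ln 2) + reflected_energy M) \<le> ennreal (ln 2) + energy M"
    by (intro LIMSEQ_le_const2) auto
  then have "ennreal (ln 2) + (reflected_energy M + ennreal (4 / real n * ?m)) \<le> ennreal (ln 2) + energy M"
    by (simp add: add_ac)
  then show ?thesis by (simp add: ennreal_add_left_cancel_le)
qed

section \<open>Energy minimisers under a quadratic map\<close>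

lemma prob_measures_onD:
  assumes "M \<in> prob_measures_on S"
  shows "prob_space M" "sets M = sets borel" "AE x in M. x \<in> S"
  using assms by (auto simp: prob_measures_on_def)

lemma half_interval_prob_if_on:
  assumes "M \<in> prob_measures_on S" "\<And>x. x \<in> S \<Longrightarrow> \<bar>x\<bar> \<le> 1/2"
  shows "half_interval_prob M"
  unfolding half_interval_prob_def
proof (intro conjI)
  show "AE x in M. \<bar>x\<bar> \<le> 1/2"
    using prob_measures_onD(3)[OF assms(1)] by eventually_elim (rule assms(2))
qed (use assms(1) prob_measures_onD in auto)

text \<open>
  Factor \<open>u\<^sup>2 - v\<^sup>2 = (u - v) (u + v)\<close>; both factors have absolute value at most \<open>1\<close>, so that no
  cancellation between positive and negative logarithms occurs.
\<close>

lemma log_kernel_ennreal_square_diff: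
  assumes u: "\<bar>u\<bar> \<le> 1/2" and v: "\<bar>v\<bar> \<le> 1/2"
  shows "log_kernel_ennreal (u\<^sup>2 - c) (v\<^sup>2 - c) = log_kernel_ennreal u v + log_kernel_ennreal u (- v)"
proof (cases "u = v \<or> u = - v")
  case True
  then show ?thesis by (auto simp: log_kernel_ennreal_eq)
next
  case False
  then have ne: "u\<^sup>2 \<noteq> v\<^sup>2" by (simp add: power2_eq_iff)
  have "\<bar>u - v\<bar> \<le> 1" "\<bar>u + v\<bar> \<le> 1" using u v by linarith+
  moreover have p: "0 < \<bar>u - v\<bar>" "0 < \<bar>u + v\<bar>" using False by auto
  ultimately have "ln \<bar>u - v\<bar> \<le> 0" "ln \<bar>u + v\<bar> \<le> 0" by simp_all
  moreover have "\<bar>u\<^sup>2 - v\<^sup>2\<bar> = \<bar>u - v\<bar> * \<bar>u + v\<bar>"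
    by (simp add: abs_mult[symmetric] power2_eq_square algebra_simps)
  then have "ln \<bar>u\<^sup>2 - v\<^sup>2\<bar> = ln \<bar>u - v\<bar> + ln \<bar>u + v\<bar>" using p by (simp add: ln_mult_pos)
  ultimately show ?thesis using False ne by (simp add: log_kernel_ennreal_eq flip: ennreal_plus)
qed

lemma energy_distr_square:
  assumes M: "half_interval_prob M"
  shows "energy (distr M borel (\<lambda>x. x\<^sup>2 - c)) = energy M + reflected_energy M"
proof -
  interpret prob_space M using M by (simp add: half_interval_prob_def)
  have [measurable_cong]: "sets M = sets borel" using M by (simp add: half_interval_prob_def)
  have AE: "AE x in M. \<bar>x\<bar> \<le> 1/2" using M by (simp add: half_interval_prob_def)
  have "energy (distr M borel (\<lambda>x. x\<^sup>2 - c)) = (\<integral>\<^sup>+x. \<integral>\<^sup>+y. log_kernel_ennreal (x\<^sup>2 - c) (y\<^sup>2 - c) \<partial>M \<partial>M)"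
    unfolding energy_def by (simp add: nn_integral_distr)
  also have "\<dots> = (\<integral>\<^sup>+x. \<integral>\<^sup>+y. log_kernel_ennreal x y + log_kernel_ennreal x (- y) \<partial>M \<partial>M)"
  proof (rule nn_integral_cong_AE)
    show "AE x in M. (\<integral>\<^sup>+y. log_kernel_ennreal (x\<^sup>2 - c) (y\<^sup>2 - c) \<partial>M) = (\<integral>\<^sup>+y. log_kernel_ennreal x y + log_kernel_ennreal x (- y) \<partial>M)"
      using AE
    proof eventually_elim
      case (elim x)
      show ?case using AE by (intro nn_integral_cong_AE) (auto elim!: eventually_mono intro!: log_kernel_ennreal_square_diff elim)
    qed
  qed
  also have "\<dots> = energy M + reflected_energy M"
    unfolding energy_def reflected_energy_def by (simp add: nn_integral_add)
  finally show ?thesis .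
qed

text \<open>
  The balanced preimage of \<open>N\<close> under \<open>x \<mapsto> x\<^sup>2 - c\<close>: a fair coin chooses the square root.
\<close>

definition sqrt_lift :: "real \<Rightarrow> real measure \<Rightarrow> real measure" where
  "sqrt_lift c N = distr (measure_pmf (bernoulli_pmf (1/2)) \<Otimes>\<^sub>M N) borel
     (\<lambda>(b, y). if b then sqrt (y + c) else - sqrt (y + c))"

lemma prob_measures_on_sqrt_lift:
  assumes N: "N \<in> prob_measures_on S'" and S: "S \<in> sets borel" 
    and lift: "\<And>y. y \<in> S' \<Longrightarrow> sqrt (y + c) \<in> S \<and> - sqrt (y + c) \<in> S"
  shows "sqrt_lift c N \<in> prob_measures_on S"
proof -
  interpret N: prob_space N using prob_measures_onD[OF N] by simp
  interpret C: prob_space "measure_pmf (bernoulli_pmf (1/2))" by (rule measure_pmf.prob_space_axioms)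
  interpret pair_prob_space "measure_pmf (bernoulli_pmf (1/2))" N ..
  have [measurable_cong]: "sets N = sets borel" using prob_measures_onD[OF N] by simp
  note [measurable] = S
  have "AE p in measure_pmf (bernoulli_pmf (1/2)) \<Otimes>\<^sub>M N. (if fst p then sqrt (snd p + c) else - sqrt (snd p + c)) \<in> S"
  proof (subst AE_pair_iff[symmetric])
    show "AE b in measure_pmf (bernoulli_pmf (1/2)). AE y in N. (if b then sqrt (y + c) else - sqrt (y + c)) \<in> S"
    proof (rule AE_I2)
      fix b
      show "AE y in N. (if b then sqrt (y + c) else - sqrt (y + c)) \<in> S"
        using prob_measures_onD(3)[OF N] by eventually_elim (use lift in auto)
    qed
  qed measurable
  then have "AE x in sqrt_lift c N. x \<in> S"
    unfolding sqrt_lift_def by (subst AE_distr_iff) (measurable, simp add: split_beta)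
  moreover have "prob_space (sqrt_lift c N)"
    unfolding sqrt_lift_def by (rule prob_space_distr) measurable
  moreover have "sets (sqrt_lift c N) = sets borel" by (simp add: sqrt_lift_def)
  ultimately show ?thesis by (simp add: prob_measures_on_def)
qed

lemma nn_integral_sqrt_lift:
  assumes N: "prob_space N" "sets N = sets borel" and [measurable]: "f \<in> borel_measurable borel"
  shows "(\<integral>\<^sup>+x. f x \<partial>sqrt_lift c N) = (\<integral>\<^sup>+y. (f (sqrt (y + c)) + f (- sqrt (y + c))) \<partial>N) / 2"
proof -
  interpret N: prob_space N by fact
  have [measurable_cong]: "sets N = sets borel" by fact
  let ?B = "measure_pmf (bernoulli_pmf (1/2))"
  have "(\<integral>\<^sup>+x. f x \<partial>sqrt_lift c N) = (\<integral>\<^sup>+p. f (if fst p then sqrt (snd p + c) else - sqrt (snd p + c)) \<partial>(?B \<Otimes>\<^sub>M N))"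
    unfolding sqrt_lift_def by (subst nn_integral_distr) (measurable, simp add: split_beta)
  also have "\<dots> = (\<integral>\<^sup>+b. \<integral>\<^sup>+y. f (if b then sqrt (y + c) else - sqrt (y + c)) \<partial>N \<partial>?B)"
    by (subst N.nn_integral_fst[symmetric]) simp_all
  also have "\<dots> = ((\<integral>\<^sup>+y. f (sqrt (y + c)) \<partial>N) + (\<integral>\<^sup>+y. f (- sqrt (y + c)) \<partial>N)) / 2"
    by (simp add: divide_ennreal_def algebra_simps ennreal_divide_numeral flip: divide_ennreal)
  finally show ?thesis by (simp add: nn_integral_add)
qed

lemma ennreal_half_plus_half: "a / 2 + a / 2 = (a :: ennreal)"
  unfolding mult_2[symmetric] ennreal_times_divide by (subst mult.commute) (simp add: mult_divide_eq_ennreal)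

text \<open>
  For each of the two square roots \<open>u\<close> of \<open>x + c\<close>, averaging the kernel over the two square roots of
  \<open>y + c\<close> gives half the kernel at \<open>(x, y)\<close>.
\<close>

lemma energy_sqrt_lift:
  assumes N: "N \<in> prob_measures_on S'"
    and lift: "\<And>y. y \<in> S' \<Longrightarrow> 0 \<le> y + c \<and> sqrt (y + c) \<le> 1/2"
  shows "energy (sqrt_lift c N) = energy N / 2"
proof -
  note p = prob_measures_onD[OF N]
  interpret N: prob_space N by fact
  have [measurable_cong]: "sets N = sets borel" by fact
  have split: "log_kernel_ennreal u (sqrt (y + c)) + log_kernel_ennreal u (- sqrt (y + c)) = log_kernel_ennreal x y"
    if "\<bar>u\<bar> = sqrt (x + c)" "x \<in> S'" "y \<in> S'" for u x y
  proof -
    have "u\<^sup>2 - c = x" using that lift[of x] by (metis add_diff_cancel_right' power2_abs real_sqrt_pow2)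
    moreover have "(sqrt (y + c))\<^sup>2 - c = y" using that lift[of y] by simp
    ultimately show ?thesis using log_kernel_ennreal_square_diff[of u "sqrt (y + c)" c] that lift[of x] lift[of y] by simp
  qed
  have inner: "(\<integral>\<^sup>+z. log_kernel_ennreal u z \<partial>sqrt_lift c N) = (\<integral>\<^sup>+y. log_kernel_ennreal x y \<partial>N) / 2"
    if "\<bar>u\<bar> = sqrt (x + c)" "x \<in> S'" for u x
  proof -
    have "AE y in N. log_kernel_ennreal u (sqrt (y + c)) + log_kernel_ennreal u (- sqrt (y + c)) = log_kernel_ennreal x y"
      using p(3) by eventually_elim (rule split[OF that])
    then have "(\<integral>\<^sup>+y. log_kernel_ennreal u (sqrt (y + c)) + log_kernel_ennreal u (- sqrt (y + c)) \<partial>N) = (\<integral>\<^sup>+y. log_kernel_ennreal x y \<partial>N)"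
      by (rule nn_integral_cong_AE)
    then show ?thesis by (subst nn_integral_sqrt_lift[OF p(1,2)]) simp_all
  qed
  interpret L: prob_space "sqrt_lift c N"
    using prob_measures_onD(1)[OF prob_measures_on_sqrt_lift[OF N, of UNIV c]] by simp
  have [measurable_cong]: "sets (sqrt_lift c N) = sets borel" by (simp add: sqrt_lift_def)
  have "energy (sqrt_lift c N) = (\<integral>\<^sup>+x. ((\<integral>\<^sup>+z. log_kernel_ennreal (sqrt (x + c)) z \<partial>sqrt_lift c N)
      + (\<integral>\<^sup>+z. log_kernel_ennreal (- sqrt (x + c)) z \<partial>sqrt_lift c N)) \<partial>N) / 2"
    unfolding energy_def by (subst nn_integral_sqrt_lift[OF p(1,2)]) simp_all
  also have "(\<integral>\<^sup>+x. ((\<integral>\<^sup>+z. log_kernel_ennreal (sqrt (x + c)) z \<partial>sqrt_lift c N)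
      + (\<integral>\<^sup>+z. log_kernel_ennreal (- sqrt (x + c)) z \<partial>sqrt_lift c N)) \<partial>N) = (\<integral>\<^sup>+x. \<integral>\<^sup>+y. log_kernel_ennreal x y \<partial>N \<partial>N)"
  proof (rule nn_integral_cong_AE)
    show "AE x in N. ((\<integral>\<^sup>+z. log_kernel_ennreal (sqrt (x + c)) z \<partial>sqrt_lift c N)
      + (\<integral>\<^sup>+z. log_kernel_ennreal (- sqrt (x + c)) z \<partial>sqrt_lift c N)) = (\<integral>\<^sup>+y. log_kernel_ennreal x y \<partial>N)"
      using p(3)
    proof eventually_elim
      case (elim x)
      have "((\<integral>\<^sup>+z. log_kernel_ennreal (sqrt (x + c)) z \<partial>sqrt_lift c N) + (\<integral>\<^sup>+z. log_kernel_ennreal (- sqrt (x + c)) z \<partial>sqrt_lift c N))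
        = (\<integral>\<^sup>+y. log_kernel_ennreal x y \<partial>N) / 2 + (\<integral>\<^sup>+y. log_kernel_ennreal x y \<partial>N) / 2"
        using elim lift[of x] by (intro arg_cong2[where f="(+)"] inner) auto
      then show ?case by (simp only: ennreal_half_plus_half)
    qed
  qed
  finally show ?thesis by (simp add: energy_def)
qed

text \<open>
  Multiplication by \<open>x\<close> maps \<open>cheb n\<close> to the mean of \<open>cheb (n + 1)\<close> and \<open>cheb (n - 1)\<close>, so
  \<open>x ^ k * cheb n x\<close> is a combination of \<open>cheb m\<close> with \<open>m\<close> of the parity of \<open>k + n\<close>.
\<close>

lemma odd_moments_zero_if_cheb:
  assumes M: "half_interval_prob M" and cheb: "\<And>n. odd n \<Longrightarrow> (LINT x|M. cheb n x) = 0"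
  shows "odd (k + n) \<Longrightarrow> (LINT x|M. x ^ k * cheb n x) = 0"
proof (induction k arbitrary: n)
  case (Suc k)
  interpret prob_space M using M by (simp add: half_interval_prob_def)
  have [measurable_cong]: "sets M = sets borel" using M by (simp add: half_interval_prob_def)
  have AE: "AE x in M. \<bar>x\<bar> \<le> 1/2" using M by (simp add: half_interval_prob_def)
  have int: "integrable M (\<lambda>x. x ^ k * cheb m x)" for m
  proof (rule integrable_const_bound)
    show "AE x in M. norm (x ^ k * cheb m x) \<le> 1"
      using AE
    proof eventually_elim
      case (elim x)
      then have "\<bar>x\<bar> ^ k * \<bar>cheb m x\<bar> \<le> 1" by (intro mult_le_one power_le_one abs_cheb_le_1) auto
      then show ?case by (simp add: abs_mult power_abs)
    qed
  qed measurable
  show ?case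
  proof (cases n)
    case 0
    then show ?thesis using Suc.IH[of 1] Suc.prems by (simp add: mult.commute)
  next
    case (Suc m)
    have "x ^ Suc k * cheb n x = (x ^ k * cheb (Suc n) x + x ^ k * cheb m x) / 2" for x
      by (simp add: Suc algebra_simps)
    then have "(LINT x|M. x ^ Suc k * cheb n x)
        = ((LINT x|M. x ^ k * cheb (Suc n) x) + (LINT x|M. x ^ k * cheb m x)) / 2"
      using int[of "Suc n"] int[of m] by (simp only: integral_divide_zero Bochner_Integration.integral_add)
    then show ?thesis using Suc.IH[of "Suc n"] Suc.IH[of m] Suc.prems by (simp add: Suc)
  qed
qed (use cheb in auto)

definition energy_minimiser :: "real set \<Rightarrow> real measure \<Rightarrow> bool" where
  "energy_minimiser S M \<longleftrightarrow>
     M \<in> prob_measures_on S \<and> (\<forall>N\<in>prob_measures_on S. energy M \<le> energy N) \<and> energy M < \<infinity>"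

text \<open>
  Lifting a competitor \<open>N\<close> on \<open>S'\<close> gives \<open>2 energy M \<le> energy N\<close>.  For \<open>N\<close> the image of \<open>M\<close>, whose
  energy is the sum of energy and reflected energy of \<open>M\<close>, this reads
  \<open>energy M \<le> reflected_energy M\<close>.  Together with \<open>reflected_energy_gap\<close> this forces equality and
  kills the odd Chebyshev moments.
\<close>

lemma energy_minimiser_square:
  assumes M: "energy_minimiser S M"
    and S: "S \<in> sets borel" "\<And>x. x \<in> S \<Longrightarrow> \<bar>x\<bar> \<le> 1/2"
    and S': "S' \<in> sets borel" "\<And>x. x \<in> S \<Longrightarrow> x\<^sup>2 - c \<in> S'"
    and lift: "\<And>y. y \<in> S' \<Longrightarrow> 0 \<le> y + c \<and> sqrt (y + c) \<in> S \<and> - sqrt (y + c) \<in> S"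
  shows "energy_minimiser S' (distr M borel (\<lambda>x. x\<^sup>2 - c))"
    and "energy (distr M borel (\<lambda>x. x\<^sup>2 - c)) = 2 * energy M"
    and "odd k \<Longrightarrow> (LINT x|M. x ^ k) = 0"
proof -
  let ?M' = "distr M borel (\<lambda>x. x\<^sup>2 - c)"
  have on: "M \<in> prob_measures_on S" and min: "\<And>N. N \<in> prob_measures_on S \<Longrightarrow> energy M \<le> energy N"
    and fin: "energy M < \<infinity>" using M by (auto simp: energy_minimiser_def)
  note p = prob_measures_onD[OF on]
  interpret prob_space M by fact
  have [measurable_cong]: "sets M = sets borel" by fact
  note [measurable] = S(1) S'(1)
  have half: "half_interval_prob M" using half_interval_prob_if_on[OF on S(2)] .
  have on': "?M' \<in> prob_measures_on S'"
    unfolding prob_measures_on_def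
  proof (intro CollectI conjI)
    show "prob_space ?M'" by (rule prob_space_distr) measurable
    have "AE x in M. x\<^sup>2 - c \<in> S'" using p(3) by eventually_elim (rule S'(2))
    then show "AE x in ?M'. x \<in> S'" by (subst AE_distr_iff) measurable
  qed simp
  have low: "2 * energy M \<le> energy N" if N: "N \<in> prob_measures_on S'" for N
  proof -
    have "energy M \<le> energy (sqrt_lift c N)"
      using lift by (intro min prob_measures_on_sqrt_lift[OF N S(1)]) auto
    also have "\<dots> = energy N / 2"
    proof (rule energy_sqrt_lift[OF N])
      fix y assume "y \<in> S'"
      with lift[of y] S(2)[of "sqrt (y + c)"] show "0 \<le> y + c \<and> sqrt (y + c) \<le> 1/2" by auto
    qed
    finally have "2 * energy M \<le> 2 * (energy N / 2)" by (rule mult_left_mono) simp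
    then show ?thesis by (simp add: ennreal_times_divide mult_divide_eq_ennreal mult.commute)
  qed
  have eq: "energy ?M' = energy M + reflected_energy M" by (rule energy_distr_square[OF half])
  have "energy M + energy M \<le> energy M + reflected_energy M"
    using low[OF on'] eq by (simp add: mult_2)
  then have ge: "energy M \<le> reflected_energy M" using fin by (auto simp: ennreal_add_left_cancel_le)
  have gap: "reflected_energy M + ennreal (4 / real n * (LINT x|M. cheb n x)\<^sup>2) \<le> energy M" if "odd n" for n
    by (rule reflected_energy_gap[OF half that])
  have le: "reflected_energy M \<le> energy M" using gap[of 1] by (auto intro: order_trans[rotated])
  then have same: "reflected_energy M = energy M" using ge by simp
  show e2: "energy ?M' = 2 * energy M" using eq same by (simp add: mult_2)
  show "energy_minimiser S' ?M'"
    using on' low fin by (auto simp: energy_minimiser_def e2 ennreal_mult_less_top)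
  have "(LINT x|M. cheb n x) = 0" if n: "odd n" for n
  proof -
    have "energy M + ennreal (4 / real n * (LINT x|M. cheb n x)\<^sup>2) \<le> energy M + 0"
      using gap[OF n] same by simp
    then have "ennreal (4 / real n * (LINT x|M. cheb n x)\<^sup>2) \<le> 0"
      using fin by (subst (asm) ennreal_add_left_cancel_le) auto
    then have "4 / real n * (LINT x|M. cheb n x)\<^sup>2 \<le> 0" by (simp add: ennreal_eq_0_iff)
    moreover have "0 < 4 / real n" using n by (auto intro: odd_pos)
    ultimately have "(LINT x|M. cheb n x)\<^sup>2 \<le> 0" by (simp only: mult_le_0_iff) linarith
    then show ?thesis by simp
  qed
  then show "odd k \<Longrightarrow> (LINT x|M. x ^ k) = 0"
    using odd_moments_zero_if_cheb[OF half, of k 0] by simp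
qed

section \<open>The equilibrium measure of the Cantor set\<close>

lemma energy_translate:
  assumes "prob_space M" "sets M = sets borel"
  shows "energy (distr M borel (\<lambda>x. x + a)) = energy M"
proof -
  interpret prob_space M by fact
  have [measurable_cong]: "sets M = sets borel" by fact
  have "energy (distr M borel (\<lambda>x. x + a)) = (\<integral>\<^sup>+x. \<integral>\<^sup>+y. log_kernel_ennreal (x + a) (y + a) \<partial>M \<partial>M)"
    unfolding energy_def by (simp add: nn_integral_distr)
  moreover have "log_kernel_ennreal (x + a) (y + a) = log_kernel_ennreal x y" for x y by (simp add: log_kernel_ennreal_eq)
  ultimately show ?thesis by (simp add: energy_def)
qed

lemma prob_measures_on_translate:
  assumes M: "M \<in> prob_measures_on S" and S: "S' \<in> sets borel" "\<And>x. x \<in> S \<Longrightarrow> x + a \<in> S'"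
  shows "distr M borel (\<lambda>x. x + a) \<in> prob_measures_on S'"
  unfolding prob_measures_on_def
proof (intro CollectI conjI)
  note p = prob_measures_onD[OF M]
  interpret prob_space M by fact
  have [measurable_cong]: "sets M = sets borel" by fact
  note [measurable] = S(1)
  show "prob_space (distr M borel (\<lambda>x. x + a))" by (rule prob_space_distr) measurable
  have "AE x in M. x + a \<in> S'" using p(3) by eventually_elim (rule S(2))
  then show "AE x in distr M borel (\<lambda>x. x + a). x \<in> S'" by (subst AE_distr_iff) measurable
qed simp

text \<open>
  On \<open>[0, 1]\<close> the negative part of the kernel vanishes.
\<close>

lemma log_energy_eq_energy:
  assumes M: "M \<in> prob_measures_on S" and S: "\<And>x. x \<in> S \<Longrightarrow> 0 \<le> x \<and> x \<le> 1"
  shows "log_energy M = enn2ereal (energy M)"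
proof -
  note p = prob_measures_onD[OF M]
  interpret prob_space M by fact
  note fubini = nn_integral_fst
  interpret pair_prob_space M M ..
  have [measurable_cong]: "sets M = sets borel" by fact
  have AE: "AE x in M. 0 \<le> x \<and> x \<le> 1" using p(3) by eventually_elim (rule S)
  have "AE x in M. AE y in M. \<bar>x - y\<bar> \<le> 1"
    using AE
  proof eventually_elim
    case (elim x)
    show ?case using AE by eventually_elim (use elim in auto)
  qed
  then have "AE p in M \<Otimes>\<^sub>M M. \<bar>fst p - snd p\<bar> \<le> 1"
    by (subst (asm) AE_pair_iff) measurable
  then have "AE p in M \<Otimes>\<^sub>M M. (case p of (x, y) \<Rightarrow> e2ennreal (- log_kernel x y)) = 0"
  proof eventually_elim
    case (elim p)
    have "- log_kernel (fst p) (snd p) \<le> 0"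
      using elim by (auto simp: log_kernel_def ln_div)
    then show ?case by (simp add: split_beta e2ennreal_neg)
  qed
  then have "(\<integral>\<^sup>+(x, y). e2ennreal (- log_kernel x y) \<partial>(M \<Otimes>\<^sub>M M)) = (\<integral>\<^sup>+p. 0 \<partial>(M \<Otimes>\<^sub>M M))"
    by (rule nn_integral_cong_AE)
  moreover have "(\<integral>\<^sup>+(x, y). e2ennreal (log_kernel x y) \<partial>(M \<Otimes>\<^sub>M M)) = energy M"
    using fubini[of "\<lambda>p. log_kernel_ennreal (fst p) (snd p)" M] unfolding log_kernel_ennreal_def[symmetric] energy_def split_beta by simp
  ultimately show ?thesis by (simp add: log_energy_def zero_ennreal.rep_eq)
qed

locale cantor_parameters =
  fixes \<gamma> :: "nat \<Rightarrow> real"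
  assumes \<gamma>_pos: "\<And>s. s \<ge> 1 \<Longrightarrow> 0 < \<gamma> s" and \<gamma>_less: "\<And>s. s \<ge> 1 \<Longrightarrow> \<gamma> s < 1/4"
begin

abbreviation r :: "nat \<Rightarrow> real" where "r \<equiv> cantor_r \<gamma>"

text \<open>
  The recursion \<open>T (s + 1) = (T s)\<^sup>2 - c s\<close> holds for the polynomials \<open>T s\<close> obtained from
  \<open>cantor_poly \<gamma> s\<close> by adding \<open>r s / 2\<close>.  Later \<open>c s\<close> turns out to be the squared norm of \<open>T s\<close>.
\<close>

definition c :: "nat \<Rightarrow> real" where
  "c s = (1 - 2 * \<gamma> (Suc s)) * (r s)\<^sup>2 / 4"

text \<open>
  The value of \<open>T (s + j)\<close> as a function of the value \<open>y\<close> of \<open>T s\<close>.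
\<close>

primrec iter :: "nat \<Rightarrow> nat \<Rightarrow> real \<Rightarrow> real" where
  "iter s 0 y = y"
| "iter s (Suc j) y = (iter s j y)\<^sup>2 - c (s + j)"

text \<open>
  The image of the Cantor set under \<open>T s\<close>, described intrinsically by its forward orbits.
\<close>

definition level_set :: "nat \<Rightarrow> real set" where
  "level_set s = {y. \<forall>j. \<bar>iter s j y\<bar> \<le> r (s + j) / 2}"

lemma r_pos: "0 < r s"
  by (induction s) (simp_all add: \<gamma>_pos)

lemma r_le_1: "r s \<le> 1"
proof (induction s)
  case (Suc s)
  have "(r s)\<^sup>2 \<le> 1" using Suc r_pos[of s] by (simp add: power_le_one)
  then have "\<gamma> (Suc s) * (r s)\<^sup>2 \<le> 1 * 1"
    using \<gamma>_less[of "Suc s"] by (intro mult_mono) auto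
  then show ?case by simp
qed simp

lemma c_plus_half_r: "c s + r (Suc s) / 2 = (r s / 2)\<^sup>2"
  by (simp add: c_def field_simps power2_eq_square)

lemma iter_Suc_shift: "iter s (Suc j) y = iter (Suc s) j (y\<^sup>2 - c s)"
  by (induction j) simp_all

lemma iter_measurable [measurable]: "iter s j \<in> borel_measurable borel"
  by (induction j) simp_all

lemma level_set_borel [measurable]: "level_set s \<in> sets borel"
  unfolding level_set_def by measurable

lemma level_set_iff: "y \<in> level_set s \<longleftrightarrow> \<bar>y\<bar> \<le> r s / 2 \<and> y\<^sup>2 - c s \<in> level_set (Suc s)"
proof -
  have all_nat: "(\<forall>j. P j) \<longleftrightarrow> P 0 \<and> (\<forall>j. P (Suc j))" for P :: "nat \<Rightarrow> bool"
    by (metis not0_implies_Suc)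
  have "y \<in> level_set s \<longleftrightarrow> \<bar>iter s 0 y\<bar> \<le> r (s + 0) / 2 \<and> (\<forall>j. \<bar>iter s (Suc j) y\<bar> \<le> r (s + Suc j) / 2)"
    unfolding level_set_def mem_Collect_eq by (rule all_nat)
  then show ?thesis by (simp only: iter_Suc_shift) (simp add: level_set_def)
qed

lemma level_set_abs_le: "y \<in> level_set s \<Longrightarrow> \<bar>y\<bar> \<le> r s / 2"
  using level_set_iff[of y s] by simp

lemma level_set_abs_le_half: "y \<in> level_set s \<Longrightarrow> \<bar>y\<bar> \<le> 1/2"
  using level_set_abs_le[of y s] r_le_1[of s] by simp

text \<open>
  Both real square roots exist and stay in the set: \<open>c s\<close> exceeds \<open>r (s + 1) / 2\<close> because
  \<open>\<gamma> (s + 1) < 1/4\<close>, and \<open>c s + r (s + 1) / 2\<close> is the square of \<open>r s / 2\<close>.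
\<close>

lemma level_set_sqrt:
  assumes "y \<in> level_set (Suc s)"
  shows "0 \<le> y + c s \<and> sqrt (y + c s) \<in> level_set s \<and> - sqrt (y + c s) \<in> level_set s"
proof -
  have y: "\<bar>y\<bar> \<le> r (Suc s) / 2" using level_set_abs_le[OF assms] .
  have "r (Suc s) / 2 \<le> c s"
  proof -
    have "c s - r (Suc s) / 2 = (1 - 4 * \<gamma> (Suc s)) * (r s)\<^sup>2 / 4" by (simp add: c_def field_simps)
    also have "\<dots> \<ge> 0" using \<gamma>_less[of "Suc s"] by simp
    finally show ?thesis by simp
  qed
  then have nn: "0 \<le> y + c s" using y by linarith
  have "y + c s \<le> (r s / 2)\<^sup>2" using y c_plus_half_r[of s] by linarith
  then have "sqrt (y + c s) \<le> r s / 2"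
    using r_pos[of s] by (intro real_le_lsqrt) auto
  then show ?thesis using nn assms by (simp add: level_set_iff[of _ s])
qed

lemma cantor_poly_eq_iter: "poly (cantor_poly \<gamma> s) x = iter 0 s (x - 1/2) - r s / 2"
proof (induction s)
  case (Suc s)
  let ?t = "iter 0 s (x - 1/2)"
  have "poly (cantor_poly \<gamma> (Suc s)) x = ?t\<^sup>2 - (r s / 2)\<^sup>2"
    by (simp add: Suc power2_eq_square algebra_simps)
  then show ?case by (simp add: flip: c_plus_half_r)
qed simp

lemma cantor_set_iff: "x \<in> cantor_set \<gamma> \<longleftrightarrow> x - 1/2 \<in> level_set 0"
proof -
  have "poly (cantor_poly \<gamma> (Suc s)) x \<le> 0 \<longleftrightarrow> \<bar>iter 0 s (x - 1/2)\<bar> \<le> r s / 2" for s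
  proof -
    have "poly (cantor_poly \<gamma> (Suc s)) x = (iter 0 s (x - 1/2))\<^sup>2 - (r s / 2)\<^sup>2"
      by (simp add: cantor_poly_eq_iter power2_eq_square algebra_simps del: iter.simps)
    also have "\<dots> \<le> 0 \<longleftrightarrow> \<bar>iter 0 s (x - 1/2)\<bar> \<le> \<bar>r s / 2\<bar>" by (simp only: diff_le_0_iff_le abs_le_square_iff)
    finally show ?thesis using r_pos[of s] by simp
  qed
  then show ?thesis by (simp add: cantor_set_def cantor_level_def level_set_def del: cantor_poly.simps)
qed

text \<open>
  The law of \<open>T s\<close> under \<open>\<mu>\<close>.
\<close>

primrec law :: "real measure \<Rightarrow> nat \<Rightarrow> real measure" where
  "law \<mu> 0 = distr \<mu> borel (\<lambda>x. x - 1/2)"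
| "law \<mu> (Suc s) = distr (law \<mu> s) borel (\<lambda>x. x\<^sup>2 - c s)"

end

locale cantor_equilibrium = cantor_parameters +
  fixes \<mu> :: "real measure"
  assumes capacity_pos: "log_capacity (cantor_set \<gamma>) > 0"
    and equilibrium: "equilibrium_measure (cantor_set \<gamma>) \<mu>"
begin

abbreviation "M \<equiv> law \<mu>"
abbreviation "Cap \<equiv> log_capacity (cantor_set \<gamma>)"

lemma cantor_set_unit: "x \<in> cantor_set \<gamma> \<Longrightarrow> 0 \<le> x \<and> x \<le> 1"
  using level_set_abs_le_half[of "x - 1/2" 0] unfolding cantor_set_iff abs_le_iff by linarith

lemma cantor_set_borel: "cantor_set \<gamma> \<in> sets borel"
proof -
  have "cantor_set \<gamma> = {x. x - 1/2 \<in> level_set 0}" using cantor_set_iff by auto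
  also have "\<dots> \<in> sets borel" by measurable
  finally show ?thesis .
qed

lemma \<mu>_on: "\<mu> \<in> prob_measures_on (cantor_set \<gamma>)"
  using equilibrium by (simp add: equilibrium_measure_def)

text \<open>
  The translation by \<open>1/2\<close> centres the Cantor set, since \<open>T 0 = x - 1/2\<close>.
\<close>

lemma log_energy_\<mu>: "log_energy \<mu> = enn2ereal (energy (M 0))"
  using log_energy_eq_energy[OF \<mu>_on cantor_set_unit] energy_translate[of \<mu> "-1/2"]
    prob_measures_onD[OF \<mu>_on] by simp

lemma energy_M_0: "energy (M 0) < \<infinity>" and Cap_eq: "Cap = exp (- enn2real (energy (M 0)))"
proof -
  have "(INF \<nu>\<in>prob_measures_on (cantor_set \<gamma>). log_energy \<nu>) = log_energy \<mu>"
    using equilibrium by (intro antisym INF_lower INF_greatest) (auto simp: equilibrium_measure_def)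
  then have cap: "Cap = (if enn2ereal (energy (M 0)) = \<infinity> then 0 else exp (- real_of_ereal (enn2ereal (energy (M 0)))))"
    by (simp add: log_capacity_def log_energy_\<mu> Let_def)
  then have "enn2ereal (energy (M 0)) \<noteq> \<infinity>" using capacity_pos by auto
  then show fin: "energy (M 0) < \<infinity>" by (auto simp: less_top[symmetric] enn2ereal_eq_top_iff)
  show "Cap = exp (- enn2real (energy (M 0)))"
    unfolding enn2real_def using cap \<open>enn2ereal (energy (M 0)) \<noteq> \<infinity>\<close> by (simp only: if_False)
qed

lemma M_0_minimiser: "energy_minimiser (level_set 0) (M 0)"
  unfolding energy_minimiser_def
proof (intro conjI ballI energy_M_0)
  show "M 0 \<in> prob_measures_on (level_set 0)"
    using prob_measures_on_translate[OF \<mu>_on, of "level_set 0" "- 1/2"] by (simp add: cantor_set_iff)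
  fix N assume N: "N \<in> prob_measures_on (level_set 0)"
  let ?N = "distr N borel (\<lambda>x. x + 1/2)"
  have on: "?N \<in> prob_measures_on (cantor_set \<gamma>)"
    by (rule prob_measures_on_translate[OF N]) (simp_all add: cantor_set_borel cantor_set_iff)
  have "log_energy \<mu> \<le> log_energy ?N" using on equilibrium by (simp add: equilibrium_measure_def)
  also have "log_energy ?N = enn2ereal (energy N)"
    using log_energy_eq_energy[OF on cantor_set_unit] energy_translate[OF prob_measures_onD(1,2)[OF N], of "1/2"]
    by (simp only:)
  finally show "energy (M 0) \<le> energy N"
    unfolding log_energy_\<mu> less_eq_ennreal.rep_eq .
qed

lemma level_set_square: "y \<in> level_set s \<Longrightarrow> y\<^sup>2 - c s \<in> level_set (Suc s)"
  using level_set_iff[of y s] by simp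

lemma M_minimiser_energy: "energy_minimiser (level_set s) (M s) \<and> energy (M s) = 2 ^ s * energy (M 0)"
proof (induction s)
  case 0
  show ?case using M_0_minimiser by simp
next
  case (Suc s)
  note step = energy_minimiser_square[OF conjunct1[OF Suc] level_set_borel level_set_abs_le_half level_set_borel
      level_set_square level_set_sqrt]
  have "energy_minimiser (level_set (Suc s)) (M (Suc s))" "energy (M (Suc s)) = 2 * energy (M s)"
    unfolding law.simps by (rule step(1); assumption) (rule step(2); assumption)
  then show ?case using Suc by (simp add: mult.assoc del: law.simps)
qed

lemmas M_minimiser = M_minimiser_energy[THEN conjunct1] and energy_M = M_minimiser_energy[THEN conjunct2]

lemma M_odd_moment: "odd k \<Longrightarrow> (LINT x|M s. x ^ k) = 0"
  by (rule energy_minimiser_square(3)[OF M_minimiser level_set_borel level_set_abs_le_half level_set_borel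
      level_set_square level_set_sqrt])

lemma M_on: "M s \<in> prob_measures_on (level_set s)"
  using M_minimiser[of s] by (simp add: energy_minimiser_def)

lemma M_half: "half_interval_prob (M s)"
  by (rule half_interval_prob_if_on[OF M_on level_set_abs_le_half])

declare law.simps [simp del]

text \<open>
  The energy of \<open>M s\<close> is \<open>2 ^ s\<close> times \<open>- ln Cap\<close>, and it is at least \<open>- ln (r s)\<close> because \<open>M s\<close> lives
  on an interval of length \<open>r s\<close>.
\<close>

lemma Cap_power_le: "Cap ^ (2 ^ s) \<le> r s"
proof -
  interpret prob_space "M s" using prob_measures_onD[OF M_on] by simp
  have AE: "AE x in M s. \<bar>x\<bar> \<le> r s / 2"
    using prob_measures_onD(3)[OF M_on] by eventually_elim (rule level_set_abs_le)
  have k: "ennreal (- ln (r s)) \<le> log_kernel_ennreal x y" if "\<bar>x\<bar> \<le> r s / 2" "\<bar>y\<bar> \<le> r s / 2" for x y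
  proof (cases "x = y")
    case False
    have "\<bar>x - y\<bar> \<le> r s" using that by linarith
    then have "ln \<bar>x - y\<bar> \<le> ln (r s)" using False r_pos[of s] by simp
    then show ?thesis using False by (simp add: log_kernel_ennreal_eq ennreal_leI)
  qed (simp add: log_kernel_ennreal_eq)
  have "ennreal (- ln (r s)) = (\<integral>\<^sup>+x. \<integral>\<^sup>+y. ennreal (- ln (r s)) \<partial>M s \<partial>M s)"
    by (simp add: emeasure_space_1)
  also have "\<dots> \<le> energy (M s)"
    unfolding energy_def
  proof (rule nn_integral_mono_AE)
    show "AE x in M s. (\<integral>\<^sup>+y. ennreal (- ln (r s)) \<partial>M s) \<le> (\<integral>\<^sup>+y. log_kernel_ennreal x y \<partial>M s)"
      using AE
    proof eventually_elim
      case (elim x)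
      have "AE y in M s. ennreal (- ln (r s)) \<le> log_kernel_ennreal x y" using AE by eventually_elim (rule k[OF elim])
      then show ?case by (rule nn_integral_mono_AE)
    qed
  qed
  also have "\<dots> = 2 ^ s * ennreal (enn2real (energy (M 0)))" using energy_M_0 by (simp add: energy_M[of s])
  also have "\<dots> = ennreal (2 ^ s * enn2real (energy (M 0)))"
    by (simp add: ennreal_mult'' flip: ennreal_power)
  finally have "- ln (r s) \<le> 2 ^ s * enn2real (energy (M 0))" by (rule ennreal_le_iff[THEN iffD1, rotated]) simp
  then have "exp (2 ^ s * - enn2real (energy (M 0))) \<le> exp (ln (r s))" by (simp only: exp_le_cancel_iff mult_minus_right)
  then show ?thesis using r_pos[of s] exp_of_nat_mult[of "2 ^ s" "- enn2real (energy (M 0))"] by (simp add: Cap_eq)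
qed


text \<open>
  An atom would give the diagonal, where the kernel is infinite, positive mass.
\<close>

lemma M_no_atoms: "emeasure (M s) {a} = 0"
proof (rule ccontr)
  assume a: "emeasure (M s) {a} \<noteq> 0"
  have [measurable_cong]: "sets (M s) = sets borel" using prob_measures_onD[OF M_on] by simp
  interpret prob_space "M s" using prob_measures_onD[OF M_on] by simp
  have "\<infinity> = \<infinity> * emeasure (M s) {a} * emeasure (M s) {a}"
    using a by (simp add: ennreal_top_mult)
  also have "\<dots> = (\<integral>\<^sup>+x. (\<infinity> * emeasure (M s) {a}) * indicator {a} x \<partial>M s)"
    by (subst nn_integral_cmult_indicator) simp_all
  also have "\<dots> \<le> energy (M s)"
    unfolding energy_def
  proof (rule nn_integral_mono)
    fix x
    have "\<infinity> * emeasure (M s) {a} = (\<integral>\<^sup>+y. \<infinity> * indicator {a} y \<partial>M s)"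
      by (subst nn_integral_cmult_indicator) simp_all
    also have "\<dots> \<le> (\<integral>\<^sup>+y. log_kernel_ennreal a y \<partial>M s)"
      by (intro nn_integral_mono) (simp add: log_kernel_ennreal_eq indicator_def)
    finally show "(\<infinity> * emeasure (M s) {a}) * indicator {a} x \<le> (\<integral>\<^sup>+y. log_kernel_ennreal x y \<partial>M s)"
      by (simp add: indicator_def)
  qed
  finally show False using M_minimiser[of s] by (simp add: energy_minimiser_def top_unique)
qed

lemma M_poly_integrable: "integrable (M s) (poly p)"
proof -
  interpret prob_space "M s" using prob_measures_onD[OF M_on] by simp
  have [measurable_cong]: "sets (M s) = sets borel" using prob_measures_onD[OF M_on] by simp
  have AE: "AE x in M s. \<bar>x\<bar> \<le> 1/2" using M_half by (simp add: half_interval_prob_def)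
  have "compact (poly p ` {-1/2..1/2})"
    by (intro compact_continuous_image continuous_intros) simp
  then obtain B where B: "\<forall>y\<in>poly p ` {-1/2..1/2}. norm y \<le> B" using compact_imp_bounded bounded_iff by metis
  have "AE x in M s. norm (poly p x) \<le> B"
    using AE
  proof eventually_elim
    case (elim x)
    then have "x \<in> {-1/2..1/2}" by (auto simp: abs_le_iff)
    then show ?case using B by blast
  qed
  moreover have "poly p \<in> borel_measurable borel"
    by (intro borel_measurable_continuous_onI continuous_intros)
  then have "poly p \<in> borel_measurable (M s)" by measurable
  ultimately show ?thesis by (rule integrable_const_bound)
qed

text \<open>
  Without atoms the finite zero set of \<open>p\<close> is a null set.  This positivity makes the monic orthogonal
  polynomials exist and be unique.
\<close>

lemma M_poly_square_pos:
  assumes "p \<noteq> 0"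
  shows "0 < (LINT x|M s. (poly p x)\<^sup>2)"
proof -
  interpret prob_space "M s" using prob_measures_onD[OF M_on] by simp
  have [measurable_cong]: "sets (M s) = sets borel" using prob_measures_onD[OF M_on] by simp
  have "poly (p\<^sup>2) = (\<lambda>x. (poly p x)\<^sup>2)" by (simp add: fun_eq_iff)
  then have int: "integrable (M s) (\<lambda>x. (poly p x)\<^sup>2)" using M_poly_integrable[of s "p\<^sup>2"] by simp
  have "(LINT x|M s. (poly p x)\<^sup>2) \<noteq> 0"
  proof
    assume "(LINT x|M s. (poly p x)\<^sup>2) = 0"
    then have "AE x in M s. (poly p x)\<^sup>2 = 0"
      using integral_nonneg_eq_0_iff_AE[OF int] by simp
    then have "AE x in M s. x \<in> {x. poly p x = 0}" by simp
    moreover have fin: "finite {x. poly p x = 0}" by (rule poly_roots_finite[OF assms])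
    have "emeasure (M s) {x. poly p x = 0} = (\<Sum>a\<in>{x. poly p x = 0}. emeasure (M s) {a})"
      by (rule emeasure_eq_sum_singleton[OF fin]) simp
    then have "emeasure (M s) {x. poly p x = 0} = 0" by (simp add: M_no_atoms)
    then have "AE x in M s. x \<notin> {x. poly p x = 0}"
      by (intro AE_not_in) (auto simp: null_sets_def prob_measures_onD[OF M_on] fin intro!: borel_closed finite_imp_closed)
    ultimately have "AE x in M s. False" by eventually_elim simp
    then show False by simp
  qed
  moreover have "0 \<le> (LINT x|M s. (poly p x)\<^sup>2)" by simp
  ultimately show ?thesis by linarith
qed

end

section \<open>Monic orthogonal polynomials of a symmetric measure\<close>

text \<open>
  For \<open>n = 0\<close> only the zero polynomial qualifies, whereas \<open>degree p < 0\<close> would exclude it too.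
  In this form the condition defines a subspace.
\<close>

definition degree_below :: "nat \<Rightarrow> real poly \<Rightarrow> bool" where
  "degree_below n p \<longleftrightarrow> (\<forall>i\<ge>n. coeff p i = 0)"

lemma degree_below_iff: "degree_below n p \<longleftrightarrow> p = 0 \<or> degree p < n"
  unfolding degree_below_def
  by (metis coeff_0 coeff_eq_0 le_degree leading_coeff_0_iff linorder_not_le order_less_le_trans)

lemma degree_below_diff_monic:
  assumes "degree p = n" "lead_coeff p = 1" "degree q = n" "lead_coeff q = 1"
  shows "degree_below n (p - q)"
  unfolding degree_below_def
proof (intro allI impI)
  fix i assume "n \<le> i"
  then show "coeff (p - q) i = 0"
    using assms by (cases "i = n") (auto simp: coeff_eq_0)
qed

lemma degree_below_monom_sum:
  assumes "degree_below n p"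
  shows "p = (\<Sum>i<n. smult (coeff p i) (monom 1 i))"
  using assms by (intro poly_eqI) (auto simp: coeff_sum degree_below_def if_distrib sum.delta not_less cong: if_cong)

lemma degree_below_mult_X: "degree_below n p \<Longrightarrow> degree_below (Suc n) ([:0, 1:] * p)"
  by (auto simp: degree_below_def coeff_pCons split: nat.split)

lemma degree_below_Suc_split:
  assumes p: "degree_below (Suc n) p" and q: "degree q = n" "lead_coeff q = 1"
  shows "degree_below n (p - smult (coeff p n) q)"
  unfolding degree_below_def
proof (intro allI impI)
  fix i assume "n \<le> i"
  then show "coeff (p - smult (coeff p n) q) i = 0"
    using p q by (cases "i = n") (auto simp: coeff_eq_0 degree_below_def)
qed

lemma real_poly_eqI: "(\<And>x. poly p x = poly q x) \<Longrightarrow> p = (q :: real poly)"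
  by (simp add: poly_eq_poly_eq_iff[symmetric] fun_eq_iff)

text \<open>
  Exactly what Gram-Schmidt orthogonalisation of the monomials requires.
\<close>

locale poly_moment_measure =
  fixes M :: "real measure"
  assumes integrable_poly: "\<And>p. integrable M (poly p)"
    and square_pos: "\<And>p. p \<noteq> 0 \<Longrightarrow> 0 < (LINT x|M. (poly p x)\<^sup>2)"
begin

definition L :: "real poly \<Rightarrow> real" where "L p = (LINT x|M. poly p x)"

abbreviation Q :: "nat \<Rightarrow> real poly" where "Q \<equiv> monic_orthogonal_poly M"

definition h :: "nat \<Rightarrow> real" where "h n = L (Q n * Q n)"

lemma L_add: "L (p + q) = L p + L q" and L_diff: "L (p - q) = L p - L q"
  and L_smult: "L (smult a p) = a * L p" and L_0 [simp]: "L 0 = 0"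
  by (simp_all add: L_def integrable_poly)

lemma L_sum: "L (\<Sum>i\<in>A. f i) = (\<Sum>i\<in>A. L (f i))"
  by (induction A rule: infinite_finite_induct) (simp_all add: L_add)

lemma L_square_pos: "p \<noteq> 0 \<Longrightarrow> 0 < L (p * p)"
  using square_pos[of p] by (simp add: L_def power2_eq_square)

lemma eq_0_if_orthogonal_self: "L (p * p) = 0 \<Longrightarrow> p = 0"
  using L_square_pos[of p] by fastforce

text \<open>
  Induction on \<open>n\<close>: the residual of \<open>x ^ n\<close> extends the space of polynomials of degree below \<open>n\<close> by
  one orthogonal direction, along which the projection is corrected.
\<close>

lemma orthogonal_projection:
  "\<exists>q. degree_below n q \<and> (\<forall>p. degree_below n p \<longrightarrow> L ((f - q) * p) = 0)"
proof (induction n arbitrary: f)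
  case 0
  show ?case by (intro exI[of _ 0]) (auto simp: degree_below_iff)
next
  case (Suc n)
  obtain q0 where q0: "degree_below n q0" "\<And>p. degree_below n p \<Longrightarrow> L ((monom 1 n - q0) * p) = 0"
    using Suc[of "monom 1 n"] by blast
  obtain q where q: "degree_below n q" "\<And>p. degree_below n p \<Longrightarrow> L ((f - q) * p) = 0"
    using Suc[of f] by blast
  define g where "g = monom 1 n - q0"
  have cg: "coeff g n = 1" "\<And>i. i > n \<Longrightarrow> coeff g i = 0" using q0(1) by (auto simp: g_def degree_below_def)
  then have dg: "degree g = n" by (metis le_degree degree_le antisym zero_neq_one)
  have "g \<noteq> 0" using cg by auto
  then have pos: "0 < L (g * g)" by (rule L_square_pos)
  define t where "t = L ((f - q) * g) / L (g * g)"
  have "L ((f - (q + smult t g)) * p) = 0" if p: "degree_below (Suc n) p" for p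
  proof -
    define p' where "p' = p - smult (coeff p n) g"
    have p': "degree_below n p'" unfolding p'_def using p dg cg by (intro degree_below_Suc_split) auto
    have "(f - (q + smult t g)) * p = smult (coeff p n) ((f - q) * g) - smult (coeff p n * t) (g * g)
        + (f - q) * p' - smult t (g * p')"
      unfolding p'_def by (rule real_poly_eqI) (simp add: algebra_simps)
    then have "L ((f - (q + smult t g)) * p) = coeff p n * L ((f - q) * g) - coeff p n * t * L (g * g)
        + L ((f - q) * p') - t * L (g * p')"
      by (simp only: L_add L_diff L_smult)
    then have "L ((f - (q + smult t g)) * p) = coeff p n * (L ((f - q) * g) - t * L (g * g))"
      using q(2)[OF p'] q0(2)[OF p'] by (simp add: g_def[symmetric] right_diff_distrib)
    then show ?thesis using pos by (simp add: t_def)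
  qed
  moreover have "degree_below (Suc n) (q + smult t g)"
    using q(1) cg by (auto simp: degree_below_def)
  ultimately show ?case by blast
qed

definition is_monic_orthogonal :: "nat \<Rightarrow> real poly \<Rightarrow> bool" where
  "is_monic_orthogonal n q \<longleftrightarrow> degree q = n \<and> lead_coeff q = 1 \<and> (\<forall>p. degree_below n p \<longrightarrow> L (q * p) = 0)"

lemma is_monic_orthogonal_unique:
  assumes "is_monic_orthogonal n p" "is_monic_orthogonal n q"
  shows "p = q"
proof -
  have "degree_below n (p - q)"
    using assms by (intro degree_below_diff_monic) (auto simp: is_monic_orthogonal_def)
  then have "L (p * (p - q)) = 0" "L (q * (p - q)) = 0"
    using assms by (auto simp: is_monic_orthogonal_def)
  then have "L ((p - q) * (p - q)) = 0" by (simp add: left_diff_distrib L_diff)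
  then show ?thesis using eq_0_if_orthogonal_self by force
qed

lemma is_monic_orthogonal_Q: "is_monic_orthogonal n (Q n)"
proof -
  obtain q0 where q0: "degree_below n q0" "\<And>p. degree_below n p \<Longrightarrow> L ((monom 1 n - q0) * p) = 0"
    using orthogonal_projection[of n "monom 1 n"] by blast
  define g where "g = monom 1 n - q0"
  have cg: "coeff g n = 1" "\<And>i. i > n \<Longrightarrow> coeff g i = 0" using q0(1) by (auto simp: g_def degree_below_def)
  then have dg: "degree g = n" by (metis le_degree degree_le antisym zero_neq_one)
  have g: "is_monic_orthogonal n g"
    unfolding is_monic_orthogonal_def using cg dg q0(2) by (auto simp: g_def)
  have eq: "(degree q = n \<and> lead_coeff q = 1 \<and> (\<forall>p. degree p < n \<longrightarrow> (LINT x|M. poly q x * poly p x) = 0))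
      \<longleftrightarrow> is_monic_orthogonal n q" for q
    by (auto simp: is_monic_orthogonal_def degree_below_iff L_def)
  show ?thesis unfolding monic_orthogonal_poly_def eq
    by (rule theI[of "is_monic_orthogonal n"], rule g, rule is_monic_orthogonal_unique[OF _ g])
qed

lemma degree_Q: "degree (Q n) = n" and lead_coeff_Q: "lead_coeff (Q n) = 1"
  and Q_orthogonal: "degree_below n p \<Longrightarrow> L (Q n * p) = 0"
  using is_monic_orthogonal_Q[of n] by (auto simp: is_monic_orthogonal_def)

lemma coeff_Q: "coeff (Q n) n = 1"
  using lead_coeff_Q[of n] by (simp add: degree_Q)

lemma Q_nonzero: "Q n \<noteq> 0"
  using coeff_Q[of n] by auto

lemma Q_eqI: "is_monic_orthogonal n q \<Longrightarrow> Q n = q"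
  using is_monic_orthogonal_unique is_monic_orthogonal_Q by blast

lemma h_pos: "0 < h n"
  unfolding h_def using lead_coeff_Q[of n] by (intro L_square_pos) auto

lemma Q_orthogonal_Q: "m < n \<Longrightarrow> L (Q n * Q m) = 0"
  by (rule Q_orthogonal) (simp add: degree_below_iff degree_Q)

lemma is_monic_orthogonalI_monom:
  assumes "degree q = n" "lead_coeff q = 1" "\<And>k. k < n \<Longrightarrow> L (q * monom 1 k) = 0"
  shows "is_monic_orthogonal n q"
  unfolding is_monic_orthogonal_def
proof (intro conjI allI impI assms)
  fix p assume "degree_below n p"
  then have "q * p = (\<Sum>i<n. smult (coeff p i) (q * monom 1 i))"
    by (subst degree_below_monom_sum[of n p]) (simp_all add: sum_distrib_left)
  then have "L (q * p) = (\<Sum>i<n. coeff p i * L (q * monom 1 i))" by (simp only: L_sum L_smult)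
  then show "L (q * p) = 0" using assms(3) by simp
qed

end

locale symmetric_moment_measure = poly_moment_measure +
  assumes odd_moment: "\<And>k. odd k \<Longrightarrow> (LINT x|M. x ^ k) = 0"
begin

abbreviation reflect :: "real poly \<Rightarrow> real poly" where "reflect p \<equiv> pcompose p [:0, -1:]"

lemma L_reflect: "L (reflect p) = L p"
proof -
  have m: "L (smult a (reflect (monom 1 i))) = L (smult a (monom 1 i))" for a i
    using odd_moment[of i] by (cases "even i") (simp_all add: L_def poly_pcompose poly_monom)
  have below: "degree_below (Suc (degree p)) p" by (simp add: degree_below_iff)
  have "L (reflect p) = L (\<Sum>i<Suc (degree p). smult (coeff p i) (reflect (monom 1 i)))"
    by (subst (1) degree_below_monom_sum[OF below]) (simp only: pcompose_sum pcompose_smult)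
  also have "\<dots> = L (\<Sum>i<Suc (degree p). smult (coeff p i) (monom 1 i))"
    by (simp only: L_sum m)
  finally show ?thesis using degree_below_monom_sum[OF below] by simp
qed

lemma L_odd: "reflect p = - p \<Longrightarrow> L p = 0"
  using L_reflect[of p] L_smult[of "-1" p] by simp

lemma reflect_reflect: "reflect (reflect p) = p"
  by (simp add: poly_eq_poly_eq_iff[symmetric] fun_eq_iff poly_pcompose)

text \<open>
  Reflection preserves the functional, so up to sign the reflected polynomial is again monic and
  orthogonal; uniqueness does the rest.
\<close>

lemma reflect_Q: "reflect (Q n) = smult ((-1) ^ n) (Q n)"
proof -
  have deg: "degree (reflect p) = degree p" for p :: "real poly" by (simp add: degree_pcompose)
  have lc: "lead_coeff (reflect (Q n)) = (-1) ^ n"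
    by (subst lead_coeff_comp) (simp_all add: coeff_Q degree_Q)
  have "is_monic_orthogonal n (smult ((-1) ^ n) (reflect (Q n)))"
    unfolding is_monic_orthogonal_def
  proof (intro conjI allI impI)
    show "degree (smult ((-1) ^ n) (reflect (Q n))) = n" by (simp add: deg degree_Q)
    show "lead_coeff (smult ((-1) ^ n) (reflect (Q n))) = 1"
      using lc by (simp add: lead_coeff_smult power_mult_distrib[symmetric])
    fix p assume "degree_below n p"
    then have "degree_below n (reflect p)" by (auto simp: degree_below_iff deg)
    then have "L (Q n * reflect p) = 0" by (rule Q_orthogonal)
    then have "L (reflect (Q n) * p) = 0"
      using L_reflect[of "Q n * reflect p"] by (simp add: pcompose_mult reflect_reflect)
    then show "L (smult ((-1) ^ n) (reflect (Q n)) * p) = 0" by (simp add: L_smult)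
  qed
  from Q_eqI[OF this] have "smult ((-1) ^ n) (Q n) = smult ((-1) ^ n * (-1) ^ n) (reflect (Q n))"
    by (metis smult_smult)
  then show ?thesis by (simp add: power_mult_distrib[symmetric])
qed

lemma L_X_Q_square: "L ([:0, 1:] * (Q n * Q n)) = 0"
proof (rule L_odd)
  have "reflect ([:0, 1:] * (Q n * Q n)) = [:0, -1:] * (smult ((-1) ^ n) (Q n) * smult ((-1) ^ n) (Q n))"
    by (simp add: pcompose_mult reflect_Q pcompose_pCons)
  also have "\<dots> = - ([:0, 1:] * (Q n * Q n))" by (simp add: power_mult_distrib[symmetric])
  finally show "reflect ([:0, 1:] * (Q n * Q n)) = - ([:0, 1:] * (Q n * Q n))" .
qed

lemma L_mult_X_Q: "L (Q (Suc n) * ([:0, 1:] * Q n)) = h (Suc n)"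
proof -
  have "degree_below (Suc n) ([:0, 1:] * Q n - Q (Suc n))"
  proof (rule degree_below_diff_monic)
    show "degree ([:0, 1:] * Q n) = Suc n" by (simp add: degree_mult_eq degree_Q Q_nonzero)
    show "lead_coeff ([:0, 1:] * Q n) = 1" by (simp only: lead_coeff_mult lead_coeff_Q) simp
  qed (simp_all add: degree_Q coeff_Q)
  then have "L (Q (Suc n) * ([:0, 1:] * Q n - Q (Suc n))) = 0" by (rule Q_orthogonal)
  then show ?thesis by (simp only: right_diff_distrib L_diff h_def)
qed

text \<open>
  The difference \<open>R\<close> of both sides has degree at most \<open>n + 1\<close>, and it is orthogonal to \<open>Q (n + 1)\<close> by
  symmetry, to \<open>Q n\<close> by the choice of the coefficient and to all polynomials of degree below \<open>n\<close>.
  Hence it is orthogonal to itself.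
\<close>

lemma Q_recurrence: "[:0, 1:] * Q (Suc n) = Q (Suc (Suc n)) + smult (h (Suc n) / h n) (Q n)"
proof -
  define R where "R = [:0, 1:] * Q (Suc n) - Q (Suc (Suc n)) - smult (h (Suc n) / h n) (Q n)"
  have below: "degree_below (Suc (Suc n)) R"
  proof -
    have "degree_below (Suc (Suc n)) ([:0, 1:] * Q (Suc n) - Q (Suc (Suc n)))"
    proof (rule degree_below_diff_monic)
      show "degree ([:0, 1:] * Q (Suc n)) = Suc (Suc n)" by (simp add: degree_mult_eq degree_Q Q_nonzero)
      show "lead_coeff ([:0, 1:] * Q (Suc n)) = 1" by (simp only: lead_coeff_mult lead_coeff_Q) simp
    qed (simp_all add: degree_Q coeff_Q)
    moreover have "degree_below (Suc (Suc n)) (smult (h (Suc n) / h n) (Q n))"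
      by (simp add: degree_below_def coeff_eq_0 degree_Q)
    ultimately show ?thesis by (simp add: R_def degree_below_def)
  qed
  have orth_low: "L (R * p) = 0" if p: "degree_below n p" for p
  proof -
    have "L (Q (Suc n) * ([:0, 1:] * p)) = 0" using degree_below_mult_X[OF p] by (rule Q_orthogonal)
    moreover have "L (Q (Suc (Suc n)) * p) = 0" using p by (intro Q_orthogonal) (auto simp: degree_below_def)
    moreover have "R * p = Q (Suc n) * ([:0, 1:] * p) - Q (Suc (Suc n)) * p - smult (h (Suc n) / h n) (Q n * p)"
      unfolding R_def by (rule real_poly_eqI) (simp add: algebra_simps)
    ultimately show ?thesis using Q_orthogonal[OF p] by (simp add: L_diff L_smult del: mult_pCons_left)
  qed
  have orth0: "L (R * Q n) = 0"
  proof -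
    have "R * Q n = Q (Suc n) * ([:0, 1:] * Q n) - Q (Suc (Suc n)) * Q n - smult (h (Suc n) / h n) (Q n * Q n)"
      unfolding R_def by (rule real_poly_eqI) (simp add: algebra_simps)
    then have "L (R * Q n) = h (Suc n) - 0 - h (Suc n) / h n * h n"
      by (simp only: L_diff L_smult L_mult_X_Q h_def[symmetric] Q_orthogonal_Q[of n "Suc (Suc n)"])
    then show ?thesis using h_pos[of n] by simp
  qed
  have orth1: "L (R * Q (Suc n)) = 0"
  proof -
    have "R * Q (Suc n) = [:0, 1:] * (Q (Suc n) * Q (Suc n)) - Q (Suc (Suc n)) * Q (Suc n) - smult (h (Suc n) / h n) (Q (Suc n) * Q n)"
      unfolding R_def by (rule real_poly_eqI) (simp add: algebra_simps)
    then show ?thesis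
      by (simp only: L_diff L_smult L_X_Q_square) (simp add: Q_orthogonal_Q)
  qed
  \<comment> \<open>Split off from \<open>R\<close> its components along \<open>Q (n + 1)\<close> and \<open>Q n\<close>.\<close>
  define R1 where "R1 = R - smult (coeff R (Suc n)) (Q (Suc n))"
  define R2 where "R2 = R1 - smult (coeff R1 n) (Q n)"
  have "degree_below (Suc n) R1" unfolding R1_def by (intro degree_below_Suc_split below) (simp_all add: degree_Q coeff_Q)
  then have "degree_below n R2" unfolding R2_def by (intro degree_below_Suc_split) (simp_all add: degree_Q coeff_Q)
  then have "L (R * R2) = 0" by (rule orth_low)
  moreover have "R * R = R * R2 + smult (coeff R1 n) (R * Q n) + smult (coeff R (Suc n)) (R * Q (Suc n))"
    unfolding R1_def R2_def by (rule real_poly_eqI) (simp add: algebra_simps)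
  ultimately have "L (R * R) = 0" by (simp add: L_add L_smult orth0 orth1)
  then have "R = 0" by (rule eq_0_if_orthogonal_self)
  then show ?thesis unfolding R_def by (simp only: diff_diff_eq right_minus_eq)
qed

lemma L_X2_Q_square:
  "L ([:0, 0, 1:] * (Q (Suc n) * Q (Suc n))) = h (Suc (Suc n)) + (h (Suc n))\<^sup>2 / h n"
proof -
  let ?a = "h (Suc n) / h n"
  have "[:0, 0, 1:] * (Q (Suc n) * Q (Suc n)) = ([:0, 1:] * Q (Suc n)) * ([:0, 1:] * Q (Suc n))"
    by (rule real_poly_eqI) (simp add: algebra_simps)
  also have "\<dots> = Q (Suc (Suc n)) * Q (Suc (Suc n)) + smult (2 * ?a) (Q (Suc (Suc n)) * Q n) + smult (?a * ?a) (Q n * Q n)"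
    unfolding Q_recurrence by (rule real_poly_eqI) (simp add: algebra_simps)
  finally have "L ([:0, 0, 1:] * (Q (Suc n) * Q (Suc n))) = h (Suc (Suc n)) + 2 * ?a * 0 + ?a * ?a * h n"
    by (simp only: L_add L_smult h_def[symmetric] Q_orthogonal_Q[of n "Suc (Suc n)"])
  then show ?thesis using h_pos[of n] by (simp add: power2_eq_square)
qed

end

section \<open>Images of symmetric measures under a quadratic map\<close>

locale quadratic_pushforward = M: symmetric_moment_measure M + N: symmetric_moment_measure N
  for M N :: "real measure" and c :: real +
  assumes sets_M: "sets M = sets borel" and N_eq: "N = distr M borel (\<lambda>x. x\<^sup>2 - c)"
    and prob: "prob_space M"
begin

abbreviation square_map :: "real poly" where "square_map \<equiv> [:- c, 0, 1:]"

lemma L_pushforward: "N.L p = M.L (pcompose p square_map)"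
proof -
  have [measurable_cong]: "sets M = sets borel" by (rule sets_M)
  have [measurable]: "poly p \<in> borel_measurable borel"
    by (intro borel_measurable_continuous_onI continuous_intros)
  have comp: "poly (pcompose p square_map) = (\<lambda>x. poly p (x\<^sup>2 - c))"
    by (simp add: fun_eq_iff poly_pcompose power2_eq_square)
  show ?thesis
    unfolding M.L_def N.L_def comp N_eq[symmetric] by (subst N_eq, subst integral_distr) simp_all
qed

lemma reflect_square_map: "pcompose (pcompose p square_map) [:0, -1:] = pcompose p square_map"
  by (simp add: poly_eq_poly_eq_iff[symmetric] fun_eq_iff poly_pcompose)

text \<open>
  Against odd powers the composition is orthogonal by symmetry of \<open>M\<close>; an even power \<open>x ^ (2 j)\<close> is the
  composition of \<open>(y + c) ^ j\<close> with the quadratic map, so orthogonality is inherited from \<open>N\<close>.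
\<close>

lemma Q_even: "M.Q (2 * n) = pcompose (N.Q n) square_map"
proof (rule M.Q_eqI, rule M.is_monic_orthogonalI_monom)
  show "degree (pcompose (N.Q n) square_map) = 2 * n" by (simp add: N.degree_Q degree_pcompose)
  show "lead_coeff (pcompose (N.Q n) square_map) = 1"
    by (subst lead_coeff_comp) (simp_all add: N.lead_coeff_Q)
  fix k assume k: "k < 2 * n"
  show "M.L (pcompose (N.Q n) square_map * monom 1 k) = 0"
  proof (cases "even k")
    case True
    then obtain j where j: "k = 2 * j" by blast
    have "pcompose (N.Q n) square_map * monom 1 k = pcompose (N.Q n * [:c, 1:] ^ j) square_map"
      by (simp add: poly_eq_poly_eq_iff[symmetric] fun_eq_iff poly_pcompose poly_monom j power_mult power2_eq_square)
    then have "M.L (pcompose (N.Q n) square_map * monom 1 k) = N.L (N.Q n * [:c, 1:] ^ j)"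
      by (simp add: L_pushforward)
    also have "\<dots> = 0"
      using k j by (intro N.Q_orthogonal) (simp add: degree_below_iff degree_power_eq)
    finally show ?thesis .
  next
    case False
    show ?thesis
    proof (rule M.L_odd)
      have "pcompose (monom 1 k) [:0, -1:] = - monom (1 :: real) k"
        using False by (simp add: poly_eq_poly_eq_iff[symmetric] fun_eq_iff poly_pcompose poly_monom)
      then show "pcompose (pcompose (N.Q n) square_map * monom 1 k) [:0, - 1:] = - (pcompose (N.Q n) square_map * monom 1 k)"
        by (simp add: pcompose_mult reflect_square_map)
    qed
  qed
qed

lemma h_even: "M.h (2 * n) = N.h n"
  by (simp add: M.h_def N.h_def Q_even L_pushforward pcompose_mult)

text \<open>
  In terms of \<open>y = x\<^sup>2 - c\<close> the factor \<open>x\<^sup>2\<close> is \<open>y + c\<close>, and the part with \<open>y\<close> vanishes by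
  symmetry of \<open>N\<close>.
\<close>

lemma L_X2_even: "M.L ([:0, 0, 1:] * (M.Q (2 * n) * M.Q (2 * n))) = c * N.h n"
proof -
  have "[:0, 0, 1:] * (M.Q (2 * n) * M.Q (2 * n)) = pcompose ([:c, 1:] * (N.Q n * N.Q n)) square_map"
    unfolding Q_even by (rule real_poly_eqI) (simp add: poly_pcompose algebra_simps)
  then have "M.L ([:0, 0, 1:] * (M.Q (2 * n) * M.Q (2 * n))) = N.L ([:c, 1:] * (N.Q n * N.Q n))"
    by (simp only: L_pushforward)
  also have "[:c, 1:] * (N.Q n * N.Q n) = smult c (N.Q n * N.Q n) + [:0, 1:] * (N.Q n * N.Q n)"
    by simp
  finally show ?thesis by (simp only: N.L_add N.L_smult N.L_X_Q_square N.h_def)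
qed

lemma Q_0: "M.Q 0 = 1"
  by (rule M.Q_eqI) (auto simp: M.is_monic_orthogonal_def degree_below_iff)

lemma h_0: "M.h 0 = 1"
proof -
  interpret prob_space M by (rule prob)
  show ?thesis by (simp add: M.h_def Q_0 M.L_def prob_space)
qed

lemma h_1: "M.h 1 = c"
proof -
  have "M.Q 1 = [:0, 1:]"
    by (rule M.Q_eqI, rule M.is_monic_orthogonalI_monom) (use M.odd_moment[of 1] in \<open>simp_all add: M.L_def poly_monom\<close>)
  moreover have "N.h 0 = 1" using h_even[of 0] h_0 by simp
  ultimately show ?thesis using L_X2_even[of 0] by (simp add: M.h_def Q_0)
qed

text \<open>
  Two evaluations of the integral of \<open>(x * Q (2 n))\<^sup>2\<close>, one by the three-term recurrence and one by the
  quadratic map.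
\<close>

lemma h_odd:
  assumes "n > 0"
  shows "M.h (Suc (2 * n)) = c * M.h (2 * n) - (M.h (2 * n))\<^sup>2 / M.h (2 * n - 1)"
proof -
  obtain m where m: "2 * n = Suc m" "m = 2 * n - 1" using assms by (cases "2 * n") auto
  show ?thesis
    using M.L_X2_Q_square[of m] L_X2_even[of n] unfolding h_even[symmetric] m(2)[symmetric] by (simp add: m(1))
qed

end

section \<open>Recursion for the squared norms\<close>

text \<open>
  The arithmetic of the norms on all levels at once: \<open>h s n\<close> stands for the squared norm of the
  \<open>n\<close>-th monic orthogonal polynomial on level \<open>s\<close>.
\<close>

locale norm_recursion =
  fixes h :: "nat \<Rightarrow> nat \<Rightarrow> real" and c :: "nat \<Rightarrow> real"
  assumes h_pos: "0 < h s n" and h_0: "h s 0 = 1" and h_1: "h s 1 = c s"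
    and h_even: "h s (2 * n) = h (Suc s) n"
    and h_odd: "n > 0 \<Longrightarrow> h s (Suc (2 * n)) = c s * h s (2 * n) - (h s (2 * n))\<^sup>2 / h s (2 * n - 1)"
    and c_Suc_le: "c (Suc s) \<le> (c s)\<^sup>2 / 4"
begin

text \<open>
  The squared off-diagonal entries of the Jacobi matrix.
\<close>

definition a :: "nat \<Rightarrow> nat \<Rightarrow> real" where "a s n = h s n / h s (n - 1)"

lemma a_pos: "0 < a s n"
  by (simp add: a_def h_pos)

lemma c_pos: "0 < c s"
  using h_pos[of s 1] h_1 by simp

lemma a_1: "a s 1 = c s"
  by (simp add: a_def h_0 flip: h_1)

lemma a_odd_plus_even: "n > 0 \<Longrightarrow> a s (Suc (2 * n)) + a s (2 * n) = c s"
  using h_pos[of s "2 * n"] by (simp add: a_def h_odd diff_divide_distrib power2_eq_square)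

lemma a_even_times_odd: "a s (2 * Suc n) * a s (Suc (2 * n)) = a (Suc s) (Suc n)"
  using h_pos[of s "Suc (2 * n)"] h_even[of s "Suc n"] h_even[of s n] by (simp add: a_def)

lemma a_le: "n > 0 \<Longrightarrow> a s n \<le> c s"
proof (cases "even n")
  case True
  assume "n > 0"
  then obtain m where "n = 2 * m" "m > 0" using True by auto
  then show ?thesis using a_odd_plus_even[of m s] a_pos[of s "Suc n"] by simp
next
  case False
  then obtain m where m: "n = Suc (2 * m)" by (auto elim!: oddE)
  show ?thesis
  proof (cases "m = 0")
    case False
    then show ?thesis using a_odd_plus_even[of m s] a_pos[of s "2 * m"] m by simp
  qed (use m a_1 in simp)
qed

lemma a_even_le: assumes "c s / 2 \<le> a s (Suc (2 * n))"
  shows "a s (2 * Suc n) \<le> 2 * a (Suc s) (Suc n) / c s"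
proof -
  have "a s (2 * Suc n) * (c s / 2) \<le> a s (2 * Suc n) * a s (Suc (2 * n))"
    using assms a_pos[of s "2 * Suc n"] by (intro mult_left_mono) auto
  then have "a s (2 * Suc n) * (c s / 2) \<le> a (Suc s) (Suc n)" unfolding a_even_times_odd .
  then show ?thesis using c_pos[of s] by (simp add: pos_le_divide_eq)
qed

text \<open>
  The product \<open>a s (2 n + 2) * a s (2 n + 1)\<close> is an entry of the next level, hence at most
  \<open>c (s + 1) \<le> (c s)\<^sup>2 / 4\<close>.  If the odd factor is at least \<open>c s / 2\<close>, the even one is at most \<open>c s / 2\<close>,
  and so the next odd entry, which is its complement in \<open>c s\<close>, is again at least \<open>c s / 2\<close>.
\<close>

lemma a_odd_ge: "c s / 2 \<le> a s (Suc (2 * n))"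
proof (induction n)
  case 0
  show ?case using a_1[of s] c_pos[of s] by simp
next
  case (Suc n)
  have "a s (2 * Suc n) \<le> 2 * a (Suc s) (Suc n) / c s" by (rule a_even_le[OF Suc])
  also have "\<dots> \<le> 2 * ((c s)\<^sup>2 / 4) / c s"
    using order_trans[OF a_le[of "Suc n" "Suc s"] c_Suc_le[of s]] c_pos[of s]
    by (intro divide_right_mono mult_left_mono) auto
  also have "\<dots> = c s / 2" using c_pos[of s] by (simp add: power2_eq_square)
  finally show ?case using a_odd_plus_even[of "Suc n" s] by simp
qed

text \<open>
  Passing from index \<open>2 ^ k\<close> on level \<open>s + 1\<close> to index \<open>2 ^ (k + 1)\<close> on level \<open>s\<close> costs the factor
  \<open>2 / c s\<close>, while \<open>c (s + 1)\<close> is at most \<open>c s\<close> times \<open>c s / 4\<close>: the bound is halved.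
\<close>

lemma a_power_2_le: "a s (2 ^ k) \<le> c s / 2 ^ k"
proof (induction k arbitrary: s)
  case 0
  show ?case using a_1[of s] by simp
next
  case (Suc k)
  obtain m where m: "2 ^ k = Suc m" by (metis not0_implies_Suc power_not_zero zero_neq_numeral)
  have "a s (2 ^ Suc k) \<le> 2 * a (Suc s) (2 ^ k) / c s"
    using a_even_le[OF a_odd_ge, of s m] by (simp only: power_Suc m)
  also have "\<dots> \<le> 2 * (((c s)\<^sup>2 / 4) / 2 ^ k) / c s"
    using order_trans[OF Suc[of "Suc s"] divide_right_mono[OF c_Suc_le[of s], of "2 ^ k"]] c_pos[of s]
    by (intro divide_right_mono mult_left_mono) auto
  also have "\<dots> = c s / 2 ^ Suc k" using c_pos[of s] by (simp add: power2_eq_square)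
  finally show ?case .
qed

lemma h_power_2: "h s (2 ^ k) = c (s + k)"
  by (induction k arbitrary: s) (simp_all add: h_even h_1[simplified])

lemma h_power_2_minus_1: "c k * 2 ^ k / c 0 \<le> h 0 (2 ^ k - 1)"
proof -
  have "h 0 (2 ^ k) = a 0 (2 ^ k) * h 0 (2 ^ k - 1)"
    using h_pos[of 0 "2 ^ k - 1"] by (simp add: a_def)
  also have "\<dots> \<le> c 0 / 2 ^ k * h 0 (2 ^ k - 1)"
    using h_pos[of 0 "2 ^ k - 1"] by (intro mult_right_mono a_power_2_le) simp
  finally show ?thesis using c_pos[of 0] by (simp add: h_power_2 field_simps)
qed

text \<open>
  Halving the index passes to the next level, with \<open>C ^ 2 ^ s\<close> squared.  An even index loses nothing;
  an odd one loses the factor \<open>a s n / (C ^ 2 ^ s)\<^sup>2 \<ge> (c s / 2) / (C ^ 2 ^ s)\<^sup>2 \<ge> 1\<close>.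
\<close>

lemma h_ratio_ge_dyadic:
  fixes C :: real
  assumes C: "0 < C" and big: "\<And>s. 2 * (C ^ 2 ^ s)\<^sup>2 \<le> c s"
  shows "2 ^ k \<le> n \<Longrightarrow> n < 2 ^ Suc k \<Longrightarrow> h s (2 ^ k) / (C ^ 2 ^ s) ^ (2 * 2 ^ k) \<le> h s n / (C ^ 2 ^ s) ^ (2 * n)"
proof (induction k arbitrary: n s)
  case 0
  then have "n = 1" by simp
  then show ?case by simp
next
  case (Suc k)
  define D where "D = C ^ 2 ^ s"
  have D: "0 < D" using C by (simp add: D_def)
  have D2: "C ^ 2 ^ Suc s = D\<^sup>2" by (simp add: D_def power_mult[symmetric] mult.commute)
  have pw: "D ^ (2 * (2 * m)) = (D\<^sup>2) ^ (2 * m)" for m by (rule power_mult)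
  define m where "m = n div 2"
  have "2 * m \<le> n" "n \<le> 2 * m + 1" unfolding m_def by linarith+
  then have "2 ^ k \<le> m" "m < 2 ^ Suc k" using Suc.prems unfolding power_Suc by linarith+
  then have IH: "h (Suc s) (2 ^ k) / (D\<^sup>2) ^ (2 * 2 ^ k) \<le> h (Suc s) m / (D\<^sup>2) ^ (2 * m)" using Suc.IH[of m "Suc s"] unfolding D2 by blast
  have "h s (2 ^ Suc k) / D ^ (2 * 2 ^ Suc k) = h (Suc s) (2 ^ k) / (D\<^sup>2) ^ (2 * 2 ^ k)"
    by (simp only: power_Suc[of "2 :: nat" k] h_even pw)
  also note IH
  also have "h (Suc s) m / (D\<^sup>2) ^ (2 * m) \<le> h s n / D ^ (2 * n)"
  proof (cases "even n")
    case True
    then have "n = 2 * m" by (simp add: m_def)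
    then show ?thesis by (simp only: h_even pw)
  next
    case False
    then have n: "n = Suc (2 * m)" by (simp add: m_def)
    have "D\<^sup>2 \<le> a s n" using big[of s] a_odd_ge[of s m] unfolding n D_def by linarith
    then have "1 \<le> a s n / D\<^sup>2" using D by (simp add: pos_le_divide_eq)
    then have "h s (2 * m) / D ^ (2 * (2 * m)) * 1 \<le> h s (2 * m) / D ^ (2 * (2 * m)) * (a s n / D\<^sup>2)"
      using h_pos[of s "2 * m"] D by (intro mult_left_mono divide_nonneg_pos) (auto intro: less_imp_le)
    also have "\<dots> = h s n / D ^ (2 * n)"
    proof -
      have "D ^ (2 * n) = D ^ (2 * (2 * m)) * D\<^sup>2" by (simp only: n mult_Suc_right power_add) (simp only: mult.commute)
      moreover have "h s n = h s (2 * m) * a s n" using h_pos[of s "2 * m"] by (simp add: a_def n)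
      ultimately show ?thesis by (simp only: times_divide_times_eq)
    qed
    finally show ?thesis by (simp only: h_even pw mult_1_right)
  qed
  finally show ?case unfolding D_def .
qed

end

section \<open>Widom factors\<close>

locale cantor_equilibrium_sixth = cantor_equilibrium +
  assumes \<gamma>_le_sixth: "\<And>s. s \<ge> 1 \<Longrightarrow> \<gamma> s \<le> 1/6"
begin

lemma four_\<gamma>_le: "4 * \<gamma> (Suc s) \<le> 1 - 2 * \<gamma> (Suc s)"
  using \<gamma>_le_sixth[of "Suc s"] by simp

text \<open>
  With \<open>\<gamma> (s + 2) > 0\<close> the claim reduces to \<open>16 (\<gamma> (s + 1))\<^sup>2 \<le> (1 - 2 \<gamma> (s + 1))\<^sup>2\<close>, which
  holds exactly for \<open>\<gamma> (s + 1) \<le> 1/6\<close>.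
\<close>

lemma c_Suc_le: "c (Suc s) \<le> (c s)\<^sup>2 / 4"
proof -
  have "c (Suc s) \<le> (r (Suc s))\<^sup>2 / 4"
    using \<gamma>_pos[of "Suc (Suc s)"] \<gamma>_less[of "Suc (Suc s)"] unfolding c_def
    by (intro divide_right_mono mult_left_le_one_le) auto
  also have "\<dots> = (4 * \<gamma> (Suc s))\<^sup>2 * (r s)\<^sup>2 * (r s)\<^sup>2 / 64" by (simp add: power2_eq_square)
  also have "\<dots> \<le> (1 - 2 * \<gamma> (Suc s))\<^sup>2 * (r s)\<^sup>2 * (r s)\<^sup>2 / 64"
    using four_\<gamma>_le[of s] \<gamma>_pos[of "Suc s"] by (intro divide_right_mono mult_right_mono power_mono) auto
  also have "\<dots> = (c s)\<^sup>2 / 4" by (simp add: c_def power2_eq_square)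
  finally show ?thesis .
qed

text \<open>
  Comparing the capacity with \<open>r\<close> two levels up gives \<open>(Cap ^ 2 ^ s) ^ 4 \<le> \<gamma> (s + 2) (\<gamma> (s + 1))\<^sup>2 (r s) ^ 4\<close>.
  One level up would only yield \<open>(Cap ^ 2 ^ s)\<^sup>2 \<le> c s\<close>, short of the factor \<open>2\<close>.
\<close>

lemma two_Cap_power_le: "2 * (Cap ^ 2 ^ s)\<^sup>2 \<le> c s"
proof -
  have cnn: "0 \<le> c s" using \<gamma>_less[of "Suc s"] by (simp add: c_def)
  have "((Cap ^ 2 ^ s)\<^sup>2)\<^sup>2 = Cap ^ 2 ^ Suc (Suc s)" by (simp add: power_mult[symmetric] mult_ac)
  also have "\<dots> \<le> \<gamma> (Suc (Suc s)) * (\<gamma> (Suc s) * (r s)\<^sup>2)\<^sup>2"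
    using Cap_power_le[of "Suc (Suc s)"] by simp
  also have "\<dots> \<le> 1 / 4 * (\<gamma> (Suc s) * (r s)\<^sup>2)\<^sup>2"
    using \<gamma>_less[of "Suc (Suc s)"] by (intro mult_right_mono) auto
  also have "\<dots> = (4 * \<gamma> (Suc s))\<^sup>2 * (r s)\<^sup>2 * (r s)\<^sup>2 / 64" by (simp add: power2_eq_square)
  also have "\<dots> \<le> (1 - 2 * \<gamma> (Suc s))\<^sup>2 * (r s)\<^sup>2 * (r s)\<^sup>2 / 64"
    using four_\<gamma>_le[of s] \<gamma>_pos[of "Suc s"] by (intro divide_right_mono mult_right_mono power_mono) auto
  also have "\<dots> = (c s / 2)\<^sup>2" by (simp add: c_def power2_eq_square)
  finally have "(Cap ^ 2 ^ s)\<^sup>2 \<le> c s / 2" by (rule power2_le_imp_le) (rule divide_nonneg_pos[OF cnn], simp)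
  then show ?thesis unfolding le_divide_eq_numeral1 by (subst mult.commute)
qed

sublocale Ms: symmetric_moment_measure "M s" for s
proof
  show "integrable (M s) (poly p)" for p by (rule M_poly_integrable)
  show "p \<noteq> 0 \<Longrightarrow> 0 < (LINT x|M s. (poly p x)\<^sup>2)" for p by (rule M_poly_square_pos)
  show "odd k \<Longrightarrow> (LINT x|M s. x ^ k) = 0" for k by (rule M_odd_moment)
qed

lemma quadratic_pushforward_M: "quadratic_pushforward (M s) (M (Suc s)) (c s)"
  by (intro quadratic_pushforward.intro quadratic_pushforward_axioms.intro Ms.symmetric_moment_measure_axioms)
    (auto simp: law.simps prob_measures_onD[OF M_on])

sublocale norm_recursion "Ms.h" c
proof
  fix s n
  show "0 < Ms.h s n" by (rule Ms.h_pos)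
  interpret quadratic_pushforward "M s" "M (Suc s)" "c s" by (rule quadratic_pushforward_M)
  show "Ms.h s 0 = 1" by (rule h_0)
  show "Ms.h s 1 = c s" by (rule h_1)
  show "Ms.h s (2 * n) = Ms.h (Suc s) n" by (rule h_even)
  show "0 < n \<Longrightarrow> Ms.h s (Suc (2 * n)) = c s * Ms.h s (2 * n) - (Ms.h s (2 * n))\<^sup>2 / Ms.h s (2 * n - 1)"
    by (rule h_odd)
  show "c (Suc s) \<le> (c s)\<^sup>2 / 4" by (rule c_Suc_le)
qed

lemma integral_\<mu>_poly: "(LINT x|\<mu>. poly (pcompose p [:- 1/2, 1:]) x) = Ms.L 0 p"
  and integrable_\<mu>_poly: "integrable \<mu> (poly (pcompose p [:- 1/2, 1:]))"
proof -
  have [measurable_cong]: "sets \<mu> = sets borel" using prob_measures_onD[OF \<mu>_on] by simp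
  have m [measurable]: "poly p \<in> borel_measurable borel"
    by (intro borel_measurable_continuous_onI continuous_intros)
  have eq: "poly (pcompose p [:- 1/2, 1:]) = (\<lambda>x. poly p (x - 1/2))" by (simp add: fun_eq_iff poly_pcompose)
  show "(LINT x|\<mu>. poly (pcompose p [:- 1/2, 1:]) x) = Ms.L 0 p"
    unfolding eq Ms.L_def by (simp add: law.simps integral_distr)
  have "integrable (distr \<mu> borel (\<lambda>x. x - 1/2)) (poly p)" using M_poly_integrable[of 0 p] by (simp add: law.simps)
  then show "integrable \<mu> (poly (pcompose p [:- 1/2, 1:]))"
    unfolding eq by (subst (asm) integrable_distr_eq) simp_all
qed

lemma pcompose_shift: "pcompose (pcompose p [:1/2, 1:]) [:- 1/2, 1:] = (p :: real poly)"
  by (rule real_poly_eqI) (simp add: poly_pcompose)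

sublocale \<mu>: poly_moment_measure \<mu>
proof
  fix p :: "real poly"
  show "integrable \<mu> (poly p)" using integrable_\<mu>_poly[of "pcompose p [:1/2, 1:]"] by (simp only: pcompose_shift)
  assume "p \<noteq> 0"
  then have ne: "pcompose p [:1/2, 1:] \<noteq> 0" using pcompose_shift[of p] by fastforce
  have "(LINT x|\<mu>. (poly p x)\<^sup>2) = (LINT x|\<mu>. poly (pcompose ((pcompose p [:1/2, 1:])\<^sup>2) [:- 1/2, 1:]) x)"
    by (simp add: poly_pcompose)
  also have "\<dots> = Ms.L 0 ((pcompose p [:1/2, 1:])\<^sup>2)" by (rule integral_\<mu>_poly)
  also have "\<dots> > 0" using Ms.L_square_pos[OF ne, of 0] by (simp add: power2_eq_square)
  finally show "0 < (LINT x|\<mu>. (poly p x)\<^sup>2)" .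
qed

text \<open>
  The polynomials of \<open>\<mu>\<close> and of its translate \<open>M 0\<close> differ by the translation, so their norms agree.
\<close>

lemma monic_orthogonal_poly_\<mu>: "monic_orthogonal_poly \<mu> n = pcompose (Ms.Q 0 n) [:- 1/2, 1:]"
proof (rule \<mu>.Q_eqI, unfold \<mu>.is_monic_orthogonal_def, intro conjI allI impI)
  show "degree (pcompose (Ms.Q 0 n) [:- 1/2, 1:]) = n" by (simp add: degree_pcompose Ms.degree_Q)
  show "lead_coeff (pcompose (Ms.Q 0 n) [:- 1/2, 1:]) = 1"
    by (subst lead_coeff_comp) (simp_all add: Ms.degree_Q Ms.coeff_Q)
  fix p assume "degree_below n p"
  then have below: "degree_below n (pcompose p [:1/2, 1:])" by (auto simp: degree_below_iff degree_pcompose)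
  have "pcompose (Ms.Q 0 n) [:- 1/2, 1:] * p = pcompose (Ms.Q 0 n * pcompose p [:1/2, 1:]) [:- 1/2, 1:]"
    by (simp only: pcompose_mult pcompose_shift)
  then have "\<mu>.L (pcompose (Ms.Q 0 n) [:- 1/2, 1:] * p) = Ms.L 0 (Ms.Q 0 n * pcompose p [:1/2, 1:])"
    by (simp only: \<mu>.L_def integral_\<mu>_poly)
  then show "\<mu>.L (pcompose (Ms.Q 0 n) [:- 1/2, 1:] * p) = 0" using Ms.Q_orthogonal[OF below] by simp
qed

definition W :: "nat \<Rightarrow> real" where "W n = widom_factor (cantor_set \<gamma>) \<mu> n"

lemma W_eq: "W n = sqrt (Ms.h 0 n / Cap ^ (2 * n))"
proof -
  have "(LINT x|\<mu>. (poly (monic_orthogonal_poly \<mu> n) x)\<^sup>2) = Ms.h 0 n"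
    using integral_\<mu>_poly[of "Ms.Q 0 n * Ms.Q 0 n"]
    by (simp add: monic_orthogonal_poly_\<mu> Ms.h_def poly_pcompose power2_eq_square)
  moreover have "sqrt (Cap ^ (2 * n)) = Cap ^ n"
    using capacity_pos by (simp add: power_even_eq less_imp_le)
  ultimately show ?thesis unfolding W_def widom_factor_def L2_norm_poly_def real_sqrt_divide by (simp only:)
qed

lemma W_ge_dyadic:
  assumes "2 ^ k \<le> n" "n < 2 ^ Suc k"
  shows "W (2 ^ k) \<le> W n"
proof -
  have "Ms.h 0 (2 ^ k) / Cap ^ (2 * 2 ^ k) \<le> Ms.h 0 n / Cap ^ (2 * n)"
    using h_ratio_ge_dyadic[OF capacity_pos two_Cap_power_le assms, of 0]
    by (simp only: power_0 power_one_right)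
  then show ?thesis unfolding W_eq by (rule real_sqrt_le_mono)
qed

text \<open>
  The polynomial of degree \<open>2 ^ k\<close> has a Widom factor bounded below, and one degree less divides its
  squared norm by \<open>a 0 (2 ^ k) \<le> c 0 / 2 ^ k\<close>.
\<close>

lemma W_power_2_minus_1: "Cap * sqrt (2 ^ k / c 0) \<le> W (2 ^ k - 1)"
proof -
  define m :: nat where "m = 2 ^ k - 1"
  have m: "2 ^ k = Suc m" by (simp add: m_def)
  have c0: "0 < c 0" by (rule c_pos)
  have "Cap\<^sup>2 * (2 ^ k / c 0) * Cap ^ (2 * m) = (Cap ^ 2 ^ k)\<^sup>2 * (2 ^ k / c 0)"
  proof -
    have "Cap\<^sup>2 * y * x\<^sup>2 = (Cap * x)\<^sup>2 * y" for x y :: real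
      by (simp only: power_mult_distrib mult.assoc mult.commute[of y])
    then show ?thesis by (simp only: m power_even_eq power_Suc)
  qed
  also have "\<dots> \<le> c k * (2 ^ k / c 0)"
    using two_Cap_power_le[of k] zero_le_power2[of "Cap ^ 2 ^ k"] c0
    by (intro mult_right_mono divide_nonneg_pos) (linarith, simp_all)
  also have "\<dots> = c k * 2 ^ k / c 0" by (rule times_divide_eq_right)
  also have "\<dots> \<le> Ms.h 0 m" unfolding m_def by (rule h_power_2_minus_1)
  finally have "Cap\<^sup>2 * (2 ^ k / c 0) \<le> Ms.h 0 m / Cap ^ (2 * m)"
    by (rule pos_le_divide_eq[THEN iffD2, OF zero_less_power[OF capacity_pos]])
  then have "sqrt (Cap\<^sup>2 * (2 ^ k / c 0)) \<le> W m" unfolding W_eq by (rule real_sqrt_le_mono)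
  moreover have "sqrt (Cap\<^sup>2 * (2 ^ k / c 0)) = Cap * sqrt (2 ^ k / c 0)"
    unfolding real_sqrt_mult using capacity_pos by (simp only: real_sqrt_abs abs_of_pos)
  ultimately show ?thesis by (simp only: m_def)
qed

lemma liminf_W: "liminf (\<lambda>s. ereal (W (2 ^ s))) = liminf (\<lambda>n. ereal (W n))"
proof (rule antisym)
  have "strict_mono (\<lambda>s. 2 ^ s :: nat)" by (rule strict_monoI) simp
  from liminf_subseq_mono[OF this, of "\<lambda>n. ereal (W n)"]
  show "liminf (\<lambda>n. ereal (W n)) \<le> liminf (\<lambda>s. ereal (W (2 ^ s)))" by (simp add: o_def)
  show "liminf (\<lambda>s. ereal (W (2 ^ s))) \<le> liminf (\<lambda>n. ereal (W n))"
    unfolding le_Liminf_iff[of _ _ "\<lambda>n. ereal (W n)"]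
  proof safe
    fix y assume "y < liminf (\<lambda>s. ereal (W (2 ^ s)))"
    then have "eventually (\<lambda>s. y < ereal (W (2 ^ s))) sequentially" by (rule less_LiminfD)
    then obtain s0 where s0: "\<And>s. s \<ge> s0 \<Longrightarrow> y < ereal (W (2 ^ s))"
      unfolding eventually_sequentially by blast
    show "eventually (\<lambda>n. y < ereal (W n)) sequentially"
      unfolding eventually_sequentially
    proof (intro exI allI impI)
      fix n :: nat assume n: "2 ^ s0 \<le> n"
      then have "1 \<le> n" by (meson one_le_numeral one_le_power order_trans)
      then obtain k where k: "2 ^ k \<le> n" "n < 2 ^ (k + 1)"
        using ex_power_ivl1[of 2 n] by auto
      \<comment> \<open>The leading binary digit of \<open>n\<close> has position at least \<open>s0\<close>.\<close>
      have "(2 :: nat) ^ s0 < 2 ^ (k + 1)" using n k by linarith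
      then have "s0 < k + 1" by (rule power_less_imp_less_exp[rotated]) simp
      then have "s0 \<le> k" by simp
      then have "y < ereal (W (2 ^ k))" by (rule s0)
      also have "\<dots> \<le> ereal (W n)" using W_ge_dyadic[of k n] k by simp
      finally show "y < ereal (W n)" .
    qed
  qed
qed

lemma limsup_W: "limsup (\<lambda>n. ereal (W n)) = \<infinity>"
proof -
  have "filterlim (\<lambda>k. x * sqrt (2 ^ k / y)) at_top sequentially" if "0 < x" "0 < y" for x y :: real
    using that by real_asymp
  from this[OF capacity_pos c_pos[of 0]]
  have "filterlim (\<lambda>k. Cap * sqrt (2 ^ k / c 0)) at_top sequentially" .
  then have "filterlim (\<lambda>k. W (2 ^ k - 1)) at_top sequentially"
    by (rule filterlim_at_top_mono) (intro always_eventually allI W_power_2_minus_1)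
  then have "(\<lambda>k. ereal (W (2 ^ k - 1))) \<longlonglongrightarrow> \<infinity>" by (simp add: tendsto_PInfty_eq_at_top)
  then have "limsup (\<lambda>k. ereal (W (2 ^ k - 1))) = \<infinity>" by (rule lim_imp_Limsup[rotated]) simp
  moreover have "limsup ((\<lambda>n. ereal (W n)) \<circ> (\<lambda>k. 2 ^ k - 1)) \<le> limsup (\<lambda>n. ereal (W n))"
    by (rule limsup_subseq_mono) (auto intro!: strict_monoI diff_less_mono)
  ultimately show ?thesis by (simp add: o_def)
qed

end

theorem theorem5p1:
  fixes \<gamma> :: "nat \<Rightarrow> real" and \<mu> :: "real measure"
  assumes "\<And>s. s \<ge> 1 \<Longrightarrow> 0 < \<gamma> s \<and> \<gamma> s < 1/4"
    and "log_capacity (cantor_set \<gamma>) > 0"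
    and "equilibrium_measure (cantor_set \<gamma>) \<mu>"
    and "\<And>s. s \<ge> 1 \<Longrightarrow> \<gamma> s \<le> 1/6"
  shows "liminf (\<lambda>s. ereal (widom_factor (cantor_set \<gamma>) \<mu> (2 ^ s))) =
           liminf (\<lambda>n. ereal (widom_factor (cantor_set \<gamma>) \<mu> n)) \<and>
         limsup (\<lambda>n. ereal (widom_factor (cantor_set \<gamma>) \<mu> n)) = \<infinity>"
proof -
  interpret cantor_equilibrium_sixth \<gamma> \<mu>
    by unfold_locales (use assms in auto)
  show ?thesis using liminf_W limsup_W by (simp add: W_def)
qed

end
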